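(* Let $t$ be a positive integer, $\mu$ a $t$-core partition and $1\le k\le t-1$. For every partition $\lambda$ with $t$-core $\mu$, $$\sum_{\substack{\square\in\lambda\\ h_\square\equiv k}}h_\square^2+\sum_{\substack{\square\in\lambda\\ h_\square\equiv t-k}}h_\square^2-\Biggl(\sum_{\substack{\square\in\lambda\\ c_\square\equiv k}}c_\square^2+\sum_{\substack{\square\in\lambda\\ c_\square\equiv t-k}}c_\square^2\Biggr)=\sum_{\substack{\square\in\mu\\ h_\square\equiv k}}h_\square^2+\sum_{\substack{\square\in\mu\\ h_\square\equiv t-k}}h_\square^2-\Biggl(\sum_{\substack{\square\in\mu\\ c_\square\equiv k}}c_\square^2+\sum_{\substack{\square\in\mu\\ c_\square\equiv t-k}}c_\square^2\Biggr)$$ $$+\sum_{(i,j)\in B_k}\Bigl(2t^2n_in_j+t(b_j+j-2b_i)d_jn_i+t(b_i+i-2b_j)d_in_j-\tfrac13t^2\bigl(d_jq_3(\lambda^i)+d_iq_3(\lambda^j)\bigr)\Bigr),$$ where all congruences are modulo $t$ and $n_i=|\lambda^i|$.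
   Context: Partitions are identified with Young diagrams (box $(i,j)$ in row $i$, column $j$; content $c_\square=j-i$); $h_\square$ is the hook length (boxes to its right in its row, plus below it in its column, plus one). A $t$-core has no hook length divisible by $t$. The 01-sequence $(z_j)_{j\in\mathbb Z}$: traverse the boundary of the Young diagram from the bottom (infinite vertical ray below the first column) to the right (infinite horizontal ray right of the first row), labelling vertical edges $0$ and horizontal edges $1$, indexed so that $\#\{j\ge0:z_j=0\}=\#\{j<0:z_j=1\}$. Removing a $t$-hook exchanges some $z_j=1,z_{j+t}=0$ into $0,1$; the $t$-core is obtained by removing $t$-hooks until impossible. The $i$-th $t$-quotient $\lambda^i$ ($0\le i\le t-1$) is the partition with 01-sequence $(z_{tj+i})_{j\in\mathbb Z}$ (up to re-indexing). For the $t$-core $\mu$ with 01-sequence $(z_{\mu,j})$: $b_i=\min\{j: j\equiv i\pmod t,\ z_{\mu,j}=1\}$, $d_i$ defined by $b_i=td_i+i$. $B_k=\{(i,i+k):0\le i\le t-1-k\}\cup\{(i,i+t-k):0\le i\le k-1\}$ as a multiset. For a partition $\nu$ with removable boxes $(\alpha_1,\beta_1),\dots,(\alpha_m,\beta_m)$, $\alpha_1>\dots>\alpha_m$, and $\alpha_{m+1}=\beta_0=0$: $q_3(\nu)=\sum_{l=0}^m(\beta_l-\alpha_{l+1})^3-\sum_{l=1}^m(\beta_l-\alpha_l)^3$. *)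

theory Defs
  imports Complex_Main "HOL-Library.Multiset" "HOL-Number_Theory.Cong"
begin

text \<open>
  A partition is its Young diagram: a finite, down-closed set of boxes $(i,j)$ (row, column),
  with rows and columns numbered from $1$.
\<close>

type_synonym diagram = "(nat \<times> nat) set"

definition young_diagram :: "diagram \<Rightarrow> bool" where
  "young_diagram \<Lambda> \<longleftrightarrow> finite \<Lambda> \<and>
     (\<forall>(i, j) \<in> \<Lambda>. 1 \<le> i \<and> 1 \<le> j \<and>
        (\<forall>i' j'. 1 \<le> i' \<and> i' \<le> i \<and> 1 \<le> j' \<and> j' \<le> j \<longrightarrow> (i', j') \<in> \<Lambda>))"

definition content :: "nat \<times> nat \<Rightarrow> int" where
  "content x = int (snd x) - int (fst x)"

definition hook :: "diagram \<Rightarrow> nat \<times> nat \<Rightarrow> nat" where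
  "hook \<Lambda> x = card {j. snd x < j \<and> (fst x, j) \<in> \<Lambda>} + card {i. fst x < i \<and> (i, snd x) \<in> \<Lambda>} + 1"

definition is_core :: "nat \<Rightarrow> diagram \<Rightarrow> bool" where
  "is_core t \<Lambda> \<longleftrightarrow> young_diagram \<Lambda> \<and> (\<forall>x\<in>\<Lambda>. \<not> t dvd hook \<Lambda> x)"

definition row_len :: "diagram \<Rightarrow> nat \<Rightarrow> nat" where
  "row_len \<Lambda> i = card {j. (i, j) \<in> \<Lambda>}"

text \<open>
  Place row $i$, column $j$ between the lattice lines $i-1,i$ and $j-1,j$. Along the boundary,
  traversed from the bottom to the right, (column) $-$ (row) increases by $1$ with every edge, and
  edge number $j$ is the one that starts where this difference equals $j$. The vertical edges are
  the right ends of the rows $i \ge 1$, including the empty ones; that of row $i$ starts at the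
  lattice point in row line $i$ and column line \<open>row_len \<Lambda> i\<close>. This numbering is the balanced one,
  see \<open>zero_one_balanced\<close> below.
\<close>

definition zero_one :: "diagram \<Rightarrow> int \<Rightarrow> nat" where
  "zero_one \<Lambda> j = (if \<exists>i\<ge>1. j = int (row_len \<Lambda> i) - int i then 0 else 1)"

lemma row_len_antimono:
  assumes "young_diagram \<Lambda>" "1 \<le> i" "i \<le> i'"
  shows "row_len \<Lambda> i' \<le> row_len \<Lambda> i"
proof -
  have "{j. (i, j) \<in> \<Lambda>} \<subseteq> snd ` \<Lambda>" by force
  then have "finite {j. (i, j) \<in> \<Lambda>}"
    using assms(1) by (auto simp: young_diagram_def intro: finite_subset)
  moreover have "{j. (i', j) \<in> \<Lambda>} \<subseteq> {j. (i, j) \<in> \<Lambda>}"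
    using assms unfolding young_diagram_def by fastforce
  ultimately show ?thesis unfolding row_len_def by (rule card_mono)
qed

lemma row_len_eventually_0:
  assumes "young_diagram \<Lambda>"
  obtains N where "\<And>i. N < i \<Longrightarrow> row_len \<Lambda> i = 0"
proof -
  have "finite (fst ` \<Lambda>)" using assms by (simp add: young_diagram_def)
  then obtain N where N: "\<forall>i \<in> fst ` \<Lambda>. i \<le> N" using finite_nat_set_iff_bounded_le by blast
  have "row_len \<Lambda> i = 0" if "N < i" for i
  proof -
    have "{j. (i, j) \<in> \<Lambda>} = {}" using N that by force
    then show ?thesis by (simp add: row_len_def)
  qed
  then show ?thesis using that by blast
qed

lemma zero_one_balanced:
  assumes "young_diagram \<Lambda>"
  shows "finite {j. 0 \<le> j \<and> zero_one \<Lambda> j = 0}" (is "finite ?Z")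
    and "finite {j. j < 0 \<and> zero_one \<Lambda> j = 1}" (is "finite ?O")
    and "card {j. 0 \<le> j \<and> zero_one \<Lambda> j = 0} = card {j. j < 0 \<and> zero_one \<Lambda> j = 1}"
proof -
  define f where "f i = int (row_len \<Lambda> i) - int i" for i
  obtain N where N: "\<And>i. N < i \<Longrightarrow> row_len \<Lambda> i = 0"
    using row_len_eventually_0[OF assms] by blast
  have less: "f i' < f i" if "1 \<le> i" "i < i'" for i i'
    using row_len_antimono[OF assms, of i i'] that by (simp add: f_def)
  have inj: "inj_on f {1..}"
    by (rule inj_onI) (metis atLeast_iff less linorder_neqE_nat order_less_irrefl)
  have zero: "zero_one \<Lambda> j = 0 \<longleftrightarrow> j \<in> f ` {1..}" for j
    by (auto simp: zero_one_def f_def)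
  have one: "zero_one \<Lambda> j = 1 \<longleftrightarrow> j \<notin> f ` {1..}" for j
    by (auto simp: zero_one_def f_def)
  define P where "P = {i \<in> {1..N}. 0 \<le> f i}"
  define Q where "Q = {i \<in> {1..N}. f i < 0}"
  have PQ: "card P + card Q = N"
  proof -
    have "P \<union> Q = {1..N}" "P \<inter> Q = {}" by (auto simp: P_def Q_def)
    moreover have "finite P" "finite Q" by (auto simp: P_def Q_def)
    ultimately show ?thesis by (metis card_Un_disjoint card_atLeastAtMost diff_Suc_1)
  qed
  have big: "f i = - int i" if "N < i" for i using N[OF that] by (simp add: f_def)
  have Z: "?Z = f ` P"
    unfolding zero P_def using big by (force simp: not_le[symmetric])
  have O: "?O = {- int N..<0} - f ` Q"
  proof (intro set_eqI iffI)
    fix j assume "j \<in> ?O"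
    then have j: "j < 0" "j \<notin> f ` {1..}" by (auto simp only: one mem_Collect_eq)
    have "- int N \<le> j"
    proof (rule ccontr)
      assume "\<not> - int N \<le> j"
      then have "N < nat (- j)" "f (nat (- j)) = j" using big[of "nat (- j)"] by auto
      then have "j \<in> f ` {1..}" by (metis atLeast_iff imageI less_one linorder_not_less not_less_zero)
      with j show False by blast
    qed
    then show "j \<in> {- int N..<0} - f ` Q" using j by (auto simp: Q_def)
  next
    fix j assume j: "j \<in> {- int N..<0} - f ` Q"
    have "j \<notin> f ` {1..}"
    proof
      assume "j \<in> f ` {1..}"
      then obtain i where i: "1 \<le> i" "j = f i" by auto
      then have "i \<le> N" using big[of i] j by force
      then show False using i j by (auto simp: Q_def)
    qed
    then show "j \<in> ?O" using j one[of j] by auto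
  qed
  have Q: "f ` Q \<subseteq> {- int N..<0}" by (auto simp: Q_def f_def)
  show "finite ?Z" unfolding Z by (simp add: P_def)
  show "finite ?O" unfolding O by simp
  have "card ?Z = card P"
    unfolding Z by (rule card_image) (rule inj_on_subset[OF inj], auto simp: P_def)
  moreover have "card (f ` Q) = card Q"
    by (rule card_image) (rule inj_on_subset[OF inj], auto simp: Q_def)
  then have "card ?O = N - card Q"
    unfolding O using Q by (subst card_Diff_subset) (auto simp: Q_def)
  ultimately show "card ?Z = card ?O" using PQ by simp
qed

definition removes_hook :: "nat \<Rightarrow> diagram \<Rightarrow> diagram \<Rightarrow> bool" where
  "removes_hook t \<Lambda> M \<longleftrightarrow> young_diagram \<Lambda> \<and> young_diagram M \<and>
     (\<exists>j. zero_one \<Lambda> j = 1 \<and> zero_one \<Lambda> (j + int t) = 0 \<and>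
          zero_one M = (zero_one \<Lambda>)(j := 0, j + int t := 1))"

definition has_core :: "nat \<Rightarrow> diagram \<Rightarrow> diagram \<Rightarrow> bool" where
  "has_core t \<Lambda> M \<longleftrightarrow> (removes_hook t)\<^sup>*\<^sup>* \<Lambda> M \<and> (\<nexists>M'. removes_hook t M M')"

text \<open>The shift \<open>s\<close> accounts for the re-indexing that balances the subsequence.\<close>

definition t_quotient :: "nat \<Rightarrow> diagram \<Rightarrow> nat \<Rightarrow> diagram" where
  "t_quotient t \<Lambda> i = (THE M. young_diagram M \<and>
     (\<exists>s. \<forall>j. zero_one M (j + s) = zero_one \<Lambda> (int t * j + int i)))"

definition core_b :: "nat \<Rightarrow> diagram \<Rightarrow> nat \<Rightarrow> int" where
  "core_b t M i = (LEAST j. [j = int i] (mod int t) \<and> zero_one M j = 1)"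

text \<open>The division is exact, so that \<open>core_b t M i = t * core_d t M i + i\<close>.\<close>

definition core_d :: "nat \<Rightarrow> diagram \<Rightarrow> nat \<Rightarrow> int" where
  "core_d t M i = (core_b t M i - int i) div int t"

definition B_pairs :: "nat \<Rightarrow> nat \<Rightarrow> (nat \<times> nat) multiset" where
  "B_pairs t k = {# (i, i + k). i \<in># mset_set {0..t - 1 - k} #}
               + {# (i, i + t - k). i \<in># mset_set {0..k - 1} #}"

definition removable :: "diagram \<Rightarrow> (nat \<times> nat) set" where
  "removable N = {x \<in> N. young_diagram (N - {x})}"

text \<open>The removable boxes $(\alpha_1,\beta_1),\dots,(\alpha_m,\beta_m)$ with
  $\alpha_1 > \dots > \alpha_m$; list positions start at $0$.\<close>

definition corners :: "diagram \<Rightarrow> (nat \<times> nat) list" where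
  "corners N = rev (sorted_key_list_of_set fst (removable N))"

definition corner_row :: "diagram \<Rightarrow> nat \<Rightarrow> int" where
  "corner_row N l = (if l = length (corners N) + 1 then 0 else int (fst (corners N ! (l - 1))))"

definition corner_col :: "diagram \<Rightarrow> nat \<Rightarrow> int" where
  "corner_col N l = (if l = 0 then 0 else int (snd (corners N ! (l - 1))))"

definition q3 :: "diagram \<Rightarrow> int" where
  "q3 N = (let m = length (corners N) in
     (\<Sum>l=0..m. (corner_col N l - corner_row N (l + 1)) ^ 3)
   - (\<Sum>l=1..m. (corner_col N l - corner_row N l) ^ 3))"

definition hook_square_sum :: "nat \<Rightarrow> nat \<Rightarrow> diagram \<Rightarrow> nat" where
  "hook_square_sum t r \<Lambda> = (\<Sum>x\<in>{x \<in> \<Lambda>. [hook \<Lambda> x = r] (mod t)}. (hook \<Lambda> x)\<^sup>2)"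

definition content_square_sum :: "nat \<Rightarrow> nat \<Rightarrow> diagram \<Rightarrow> int" where
  "content_square_sum t r \<Lambda> = (\<Sum>x\<in>{x \<in> \<Lambda>. [content x = int r] (mod int t)}. (content x)\<^sup>2)"

end

theory Submission
  imports Defs
begin

text \<open>
  Boxes correspond to inversions of the 01-sequence (pairs $a < b$ with $z_a = 1$, $z_b = 0$), with
  hook length $b - a$. Removing a $t$-hook moves a zero from $p + t$ to $p$. For a residue class
  $j \equiv p \pm k$, the squared hook lengths of the inversions between this zero and class $j$
  change by an affine function of the position, summed over the class; this sum is $2 t^2 n_j$ plus
  a polynomial in $p$, $j$ and $d_j$. The polynomial contains $(p + t - j)^2$, which is exactly the
  squared content lost in the residue class $\mp k$, since the removed boxes have the contents
  $p + 1, \dots, p + t$. What remains is the change of the right-hand side when one box is removed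
  from $\lambda^i$, because $q_3(\nu)$ is six times the sum of the contents of $\nu$. The theorem
  follows by induction along a chain of hook removals from $\lambda$ to $\mu$.
\<close>

subsection \<open>Diagrams and their 01-sequences\<close>

text \<open>The sums for k and t - k have to be treated together. Seen from the moving zero, a class
  at distance k to the right is at distance t - k to the left (mod t); only the symmetric weight
  lets both sides contribute the same affine function of the position x, with weight 1 - z_x on the
  right and -z_x on the left. Together these weights form a step function minus z. The sequence z on
  class j is in turn a step at d_j, disturbed by the boxes of the quotient, and every such box
  contributes the second difference 2 t^2 of the squares. The moved position p enters the change of
  the hook squares quadratically, whereas a box of the quotient changes n_i by 1 and its content sum
  by an affine function of p. Subtracting the content squares removes just the quadratic part. The
  d_j belong to the core and can serve for all diagrams of the chain, because zeros move inside
  their residue classes; read backwards, the chain starts from empty quotients with shifts d_j. The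
  constant 1/3 is 2/6: a coefficient 2 t^2 of the content sum becomes t^2/3 in front of q_3.\<close>

lemma young_diagram_boxD:
  assumes "young_diagram \<Lambda>" "(i, j) \<in> \<Lambda>"
  shows "1 \<le> i \<and> 1 \<le> j \<and> (\<forall>i' j'. 1 \<le> i' \<and> i' \<le> i \<and> 1 \<le> j' \<and> j' \<le> j \<longrightarrow> (i', j') \<in> \<Lambda>)"
proof -
  have "\<forall>(i, j) \<in> \<Lambda>. 1 \<le> i \<and> 1 \<le> j \<and>
      (\<forall>i' j'. 1 \<le> i' \<and> i' \<le> i \<and> 1 \<le> j' \<and> j' \<le> j \<longrightarrow> (i', j') \<in> \<Lambda>)"
    using assms(1) unfolding young_diagram_def by (rule conjunct2)
  from bspec[OF this assms(2), unfolded prod.case] show ?thesis .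
qed

lemma young_diagram_down:
  assumes "young_diagram \<Lambda>" "(i, j) \<in> \<Lambda>" "1 \<le> i'" "i' \<le> i" "1 \<le> j'" "j' \<le> j"
  shows "(i', j') \<in> \<Lambda>"
  using young_diagram_boxD[OF assms(1,2)] assms(3-) by iprover

lemma young_diagram_pos:
  assumes "young_diagram \<Lambda>" "(i, j) \<in> \<Lambda>"
  shows "1 \<le> i" "1 \<le> j"
  using young_diagram_boxD[OF assms(1,2)] by iprover+

lemma young_diagramI:
  assumes "finite \<Lambda>" "\<And>i j. (i, j) \<in> \<Lambda> \<Longrightarrow> 1 \<le> i" "\<And>i j. (i, j) \<in> \<Lambda> \<Longrightarrow> 1 \<le> j"
    "\<And>i j i' j'. (i, j) \<in> \<Lambda> \<Longrightarrow> 1 \<le> i' \<Longrightarrow> i' \<le> i \<Longrightarrow> 1 \<le> j' \<Longrightarrow> j' \<le> j \<Longrightarrow> (i', j') \<in> \<Lambda>"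
  shows "young_diagram \<Lambda>"
  unfolding young_diagram_def
proof (rule conjI[OF assms(1)], rule ballI, rule case_prodI2, intro conjI allI impI)
  fix x i j assume "x \<in> \<Lambda>" "x = (i, j)"
  then have ij: "(i, j) \<in> \<Lambda>" by simp
  from ij show "1 \<le> i" by (rule assms(2))
  from ij show "1 \<le> j" by (rule assms(3))
  fix i' j' assume "1 \<le> i' \<and> i' \<le> i \<and> 1 \<le> j' \<and> j' \<le> j"
  then show "(i', j') \<in> \<Lambda>" using assms(4)[OF ij] by simp
qed

lemma young_diagram_finite: "young_diagram \<Lambda> \<Longrightarrow> finite \<Lambda>"
  by (simp add: young_diagram_def)

lemma young_diagram_empty [simp]: "young_diagram {}"
  by (simp add: young_diagram_def)

lemma young_diagram_converse:
  assumes "young_diagram \<Lambda>"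
  shows "young_diagram (\<Lambda>\<inverse>)"
proof (rule young_diagramI)
  show "finite (\<Lambda>\<inverse>)" using young_diagram_finite[OF assms] by simp
qed (unfold converse_iff, (fact young_diagram_pos[OF assms])+, rule young_diagram_down[OF assms])

lemma young_diagram_row:
  assumes "young_diagram \<Lambda>"
  shows "{j. (i, j) \<in> \<Lambda>} = {1..row_len \<Lambda> i}"
proof -
  let ?S = "{j. (i, j) \<in> \<Lambda>}"
  have "?S \<subseteq> snd ` \<Lambda>" by force
  then have fin: "finite ?S"
    using young_diagram_finite[OF assms] finite_subset by blast
  show ?thesis
  proof (cases "?S = {}")
    case True
    then show ?thesis by (simp add: row_len_def)
  next
    case False
    with fin have "Max ?S \<in> ?S" by (rule Max_in)
    then have "(i, Max ?S) \<in> \<Lambda>" by blast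
    then have "j \<in> ?S" if "j \<in> {1..Max ?S}" for j
      using young_diagram_down[OF assms, of i "Max ?S" i j] young_diagram_pos(1)[OF assms, of i "Max ?S"] that
      by simp
    moreover have "j \<in> {1..Max ?S}" if "j \<in> ?S" for j
      using that Max_ge[OF fin that] young_diagram_pos(2)[OF assms, of i j] by simp
    ultimately have eq: "?S = {1..Max ?S}" by blast
    then have "row_len \<Lambda> i = Max ?S"
      unfolding row_len_def using card_atLeastAtMost[of 1 "Max ?S"] by simp
    with eq show ?thesis by metis
  qed
qed

lemma young_diagram_mem_iff:
  assumes "young_diagram \<Lambda>"
  shows "(i, j) \<in> \<Lambda> \<longleftrightarrow> 1 \<le> j \<and> j \<le> row_len \<Lambda> i"
  using young_diagram_row[OF assms, of i] by auto

lemma young_diagram_mem_iff_col: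
  assumes "young_diagram \<Lambda>"
  shows "(i, j) \<in> \<Lambda> \<longleftrightarrow> 1 \<le> i \<and> i \<le> row_len (\<Lambda>\<inverse>) j"
  using young_diagram_mem_iff[OF young_diagram_converse[OF assms], of j i] by simp

lemma row_len_minus_strict_antimono:
  assumes "young_diagram \<Lambda>" "1 \<le> i" "i < i'"
  shows "int (row_len \<Lambda> i') - int i' < int (row_len \<Lambda> i) - int i"
  using row_len_antimono[OF assms(1,2), of i'] assms(3) by simp

lemma row_len_minus_eq_iff:
  assumes "young_diagram \<Lambda>" "1 \<le> i" "1 \<le> i'"
  shows "int (row_len \<Lambda> i) - int i = int (row_len \<Lambda> i') - int i' \<longleftrightarrow> i = i'"
  using row_len_minus_strict_antimono[OF assms(1,2), of i'] row_len_minus_strict_antimono[OF assms(1,3), of i]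
  by (cases i i' rule: linorder_cases) auto

lemma zero_one_eq_0_iff: "zero_one \<Lambda> m = 0 \<longleftrightarrow> (\<exists>i\<ge>1. m = int (row_len \<Lambda> i) - int i)"
  by (simp add: zero_one_def)

lemma zero_one_neq_0_iff: "zero_one \<Lambda> m \<noteq> 0 \<longleftrightarrow> zero_one \<Lambda> m = 1"
  by (simp add: zero_one_def)

text \<open>The positions missed by the row ends are the bottom edges of the columns, empty columns
  included; \<open>\<Lambda>\<inverse>\<close> is the transposed diagram, so its row lengths are the
  column lengths.\<close>

lemma zero_one_eq_1_iff:
  assumes "young_diagram \<Lambda>"
  shows "zero_one \<Lambda> m = 1 \<longleftrightarrow> (\<exists>j\<ge>1. m = int j - 1 - int (row_len (\<Lambda>\<inverse>) j))"
proof
  assume one: "zero_one \<Lambda> m = 1"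
  obtain N where "\<forall>i>N. row_len \<Lambda> i = 0"
    using row_len_eventually_0[OF assms] by blast
  then have N: "row_len \<Lambda> i = 0" if "N < i" for i using that by blast
  let ?P = "\<lambda>i. int (row_len \<Lambda> (Suc i)) - int (Suc i) < m"
  have "?P (N + nat \<bar>m\<bar>)" using N by simp
  then have P: "?P (LEAST i. ?P i)" by (rule LeastI)
  \<comment> \<open>\<open>i\<close> counts the rows whose vertical edge comes after position
    \<open>m\<close>. Edge \<open>m\<close> therefore runs along row line \<open>i\<close> and
    starts in column line \<open>m + i\<close>: it is the bottom of column
    \<open>m + i + 1\<close>.\<close>
  define i where "i = (LEAST i. ?P i)"
  have lt: "int (row_len \<Lambda> (Suc i)) - int (Suc i) < m" using P by (simp only: i_def)
  have gt: "m < int (row_len \<Lambda> i) - int i" if "1 \<le> i"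
  proof -
    have "\<not> ?P (i - 1)" using that not_less_Least[of "i - 1" ?P] by (simp add: i_def)
    moreover have "m \<noteq> int (row_len \<Lambda> i) - int i"
    proof
      assume "m = int (row_len \<Lambda> i) - int i"
      then have "zero_one \<Lambda> m = 0" using that unfolding zero_one_eq_0_iff by blast
      then show False using one by simp
    qed
    ultimately show ?thesis using that by simp
  qed
  define j where "j = nat (m + 1 + int i)"
  have j: "int j = m + 1 + int i" "1 \<le> j" using lt by (auto simp: j_def)
  have "(Suc i, j) \<notin> \<Lambda>" using lt j young_diagram_mem_iff[OF assms] by simp
  then have "row_len (\<Lambda>\<inverse>) j \<le> i" using young_diagram_mem_iff_col[OF assms, of "Suc i" j] by simp
  moreover have "i \<le> row_len (\<Lambda>\<inverse>) j"
  proof (cases "1 \<le> i")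
    case True
    then have "(i, j) \<in> \<Lambda>" using gt j young_diagram_mem_iff[OF assms] by simp
    then show ?thesis using young_diagram_mem_iff_col[OF assms] by blast
  qed simp
  ultimately show "\<exists>j\<ge>1. m = int j - 1 - int (row_len (\<Lambda>\<inverse>) j)" using j by force
next
  assume "\<exists>j\<ge>1. m = int j - 1 - int (row_len (\<Lambda>\<inverse>) j)"
  then obtain j where j: "1 \<le> j" "m = int j - 1 - int (row_len (\<Lambda>\<inverse>) j)" by blast
  have "m \<noteq> int (row_len \<Lambda> i) - int i" if "1 \<le> i" for i
    using young_diagram_mem_iff[OF assms, of i j] young_diagram_mem_iff_col[OF assms, of i j] j that
    by linarith
  then show "zero_one \<Lambda> m = 1" unfolding zero_one_neq_0_iff[symmetric] zero_one_eq_0_iff by blast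
qed

lemma hook_eq:
  assumes "young_diagram \<Lambda>" "(i, j) \<in> \<Lambda>"
  shows "int (hook \<Lambda> (i, j)) = (int (row_len \<Lambda> i) - int i) - (int j - 1 - int (row_len (\<Lambda>\<inverse>) j))"
proof -
  have "{j'. j < j' \<and> (i, j') \<in> \<Lambda>} = {j<..row_len \<Lambda> i}"
    using young_diagram_mem_iff[OF assms(1)] by auto
  moreover have "{i'. i < i' \<and> (i', j) \<in> \<Lambda>} = {i<..row_len (\<Lambda>\<inverse>) j}"
    using young_diagram_mem_iff_col[OF assms(1)] by auto
  moreover have "j \<le> row_len \<Lambda> i" "i \<le> row_len (\<Lambda>\<inverse>) j"
    using assms young_diagram_mem_iff young_diagram_mem_iff_col by blast+
  ultimately show ?thesis by (simp add: hook_def)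
qed

text \<open>A box goes to the bottom edge of its column and the right edge of its row. Row
  \<open>i\<close> and column \<open>j\<close> cross inside the diagram exactly when the column edge
  comes first on the boundary.\<close>

lemma bij_betw_boxes_inversions:
  assumes "young_diagram \<Lambda>"
  shows "bij_betw (\<lambda>(i, j). (int j - 1 - int (row_len (\<Lambda>\<inverse>) j), int (row_len \<Lambda> i) - int i)) \<Lambda>
    {(a, b). a < b \<and> zero_one \<Lambda> a = 1 \<and> zero_one \<Lambda> b = 0}"
    (is "bij_betw ?f _ ?I")
proof (rule bij_betw_imageI)
  note conv = young_diagram_converse[OF assms]
  show "inj_on ?f \<Lambda>"
  proof (rule inj_onI, clarify)
    fix i j i' j'
    assume *: "(i, j) \<in> \<Lambda>" "(i', j') \<in> \<Lambda>"
      "int j - 1 - int (row_len (\<Lambda>\<inverse>) j) = int j' - 1 - int (row_len (\<Lambda>\<inverse>) j')"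
      "int (row_len \<Lambda> i) - int i = int (row_len \<Lambda> i') - int i'"
    then have "int (row_len (\<Lambda>\<inverse>) j) - int j = int (row_len (\<Lambda>\<inverse>) j') - int j'" by linarith
    then show "i = i' \<and> j = j'"
      using row_len_minus_eq_iff[OF assms, of i i'] row_len_minus_eq_iff[OF conv, of j j']
        young_diagram_pos[OF assms *(1)] young_diagram_pos[OF assms *(2)] *(4)
      by blast
  qed
  show "?f ` \<Lambda> = ?I"
  proof (intro set_eqI iffI)
    fix y assume "y \<in> ?f ` \<Lambda>"
    then obtain i j where x: "(i, j) \<in> \<Lambda>"
      and y: "y = (int j - 1 - int (row_len (\<Lambda>\<inverse>) j), int (row_len \<Lambda> i) - int i)" by auto
    have "0 < hook \<Lambda> (i, j)" by (simp add: hook_def)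
    then have "fst y < snd y" using hook_eq[OF assms x] y by simp
    moreover have "zero_one \<Lambda> (fst y) = 1"
      using y young_diagram_pos[OF assms x] by (subst zero_one_eq_1_iff[OF assms]) auto
    moreover have "zero_one \<Lambda> (snd y) = 0"
      using y young_diagram_pos[OF assms x] by (subst zero_one_eq_0_iff) auto
    ultimately show "y \<in> ?I" by (simp add: case_prod_beta)
  next
    fix y assume "y \<in> ?I"
    then obtain a b where y: "y = (a, b)" "a < b" "zero_one \<Lambda> a = 1" "zero_one \<Lambda> b = 0" by auto
    obtain j where j: "1 \<le> j" "a = int j - 1 - int (row_len (\<Lambda>\<inverse>) j)"
      using y zero_one_eq_1_iff[OF assms] by blast
    obtain i where i: "1 \<le> i" "b = int (row_len \<Lambda> i) - int i"
      using y zero_one_eq_0_iff by blast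
    have "(i, j) \<in> \<Lambda>"
      using young_diagram_mem_iff[OF assms, of i j] young_diagram_mem_iff_col[OF assms, of i j] i j \<open>a < b\<close>
      by linarith
    then show "y \<in> ?f ` \<Lambda>" using i j y by force
  qed
qed

lemma sum_hook_eq_sum_inversions:
  assumes "young_diagram \<Lambda>"
  shows "(\<Sum>x\<in>\<Lambda>. w (int (hook \<Lambda> x)))
    = (\<Sum>(a, b)\<in>{(a, b). a < b \<and> zero_one \<Lambda> a = 1 \<and> zero_one \<Lambda> b = 0}. w (b - a))"
proof -
  have "(\<Sum>x\<in>\<Lambda>. w (int (hook \<Lambda> x)))
    = (\<Sum>x\<in>\<Lambda>. case (case x of (i, j) \<Rightarrow>
        (int j - 1 - int (row_len (\<Lambda>\<inverse>) j), int (row_len \<Lambda> i) - int i)) of (a, b) \<Rightarrow> w (b - a))"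
    using hook_eq[OF assms] by (intro sum.cong) auto
  also have "\<dots> = (\<Sum>(a, b)\<in>{(a, b). a < b \<and> zero_one \<Lambda> a = 1 \<and> zero_one \<Lambda> b = 0}. w (b - a))"
    by (rule sum.reindex_bij_betw[OF bij_betw_boxes_inversions[OF assms]])
  finally show ?thesis .
qed

text \<open>A one at \<open>m\<close> with a zero at \<open>m + t\<close> would be an inversion,
  hence a box of hook length \<open>t\<close>.\<close>

lemma core_zero_one_step:
  assumes "is_core t \<Lambda>" "0 < t" "zero_one \<Lambda> m = 1"
  shows "zero_one \<Lambda> (m + int t) = 1"
proof (rule ccontr)
  assume "zero_one \<Lambda> (m + int t) \<noteq> 1"
  then have "zero_one \<Lambda> (m + int t) = 0" using zero_one_neq_0_iff by blast
  moreover have young: "young_diagram \<Lambda>" using assms(1) by (simp add: is_core_def)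
  ultimately have "(m, m + int t) \<in> {(a, b). a < b \<and> zero_one \<Lambda> a = 1 \<and> zero_one \<Lambda> b = 0}"
    using assms by simp
  then obtain x where "x \<in> \<Lambda>" "(m, m + int t) = (case x of (i, j) \<Rightarrow>
      (int j - 1 - int (row_len (\<Lambda>\<inverse>) j), int (row_len \<Lambda> i) - int i))"
    unfolding bij_betw_imp_surj_on[OF bij_betw_boxes_inversions[OF young], symmetric] by (rule imageE)
  then obtain i j where "(i, j) \<in> \<Lambda>"
    "m = int j - 1 - int (row_len (\<Lambda>\<inverse>) j)" "m + int t = int (row_len \<Lambda> i) - int i"
    by (cases x) simp
  then have "hook \<Lambda> (i, j) = t" "(i, j) \<in> \<Lambda>" using hook_eq[OF young, of i j] by simp_all
  then have "t dvd hook \<Lambda> (i, j)" "(i, j) \<in> \<Lambda>" by simp_all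
  then show False using assms(1) unfolding is_core_def by blast
qed

lemma zero_one_bounds:
  assumes "young_diagram \<Lambda>"
  obtains K where "0 \<le> K" "\<And>m. m < - K \<Longrightarrow> zero_one \<Lambda> m = 0" "\<And>m. K \<le> m \<Longrightarrow> zero_one \<Lambda> m = 1"
proof -
  obtain N where "\<forall>i>N. row_len \<Lambda> i = 0"
    using row_len_eventually_0[OF assms] by blast
  then have N: "row_len \<Lambda> i = 0" if "N < i" for i using that by blast
  define K where "K = int (N + row_len \<Lambda> 1)"
  have "zero_one \<Lambda> m = 0" if "m < - K" for m
  proof -
    define i where "i = nat (- m)"
    have i: "N < i" "1 \<le> i" "m = - int i" using that by (simp_all add: K_def i_def)
    then have "m = int (row_len \<Lambda> i) - int i" using N by simp
    with i(2) show ?thesis unfolding zero_one_eq_0_iff by blast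
  qed
  moreover have "zero_one \<Lambda> m = 1" if "K \<le> m" for m
  proof -
    have "m \<noteq> int (row_len \<Lambda> i) - int i" if "1 \<le> i" for i
      using row_len_antimono[OF assms order_refl that] \<open>K \<le> m\<close> that by (simp add: K_def)
    then show ?thesis unfolding zero_one_neq_0_iff[symmetric] zero_one_eq_0_iff by blast
  qed
  ultimately show thesis by (intro that[of K]) (simp_all add: K_def)
qed

section \<open>Adding a box\<close>

lemma row_len_insert:
  assumes "young_diagram \<nu>" "young_diagram (insert (i, j) \<nu>)" "(i, j) \<notin> \<nu>"
  shows "row_len \<nu> i = j - 1" "row_len (insert (i, j) \<nu>) i = j"
    "i' \<noteq> i \<Longrightarrow> row_len (insert (i, j) \<nu>) i' = row_len \<nu> i'"
proof -
  let ?\<Lambda> = "insert (i, j) \<nu>"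
  note mem = young_diagram_mem_iff[OF assms(1)] young_diagram_mem_iff[OF assms(2)]
  have j: "1 \<le> j" "j \<le> row_len ?\<Lambda> i" "\<not> j \<le> row_len \<nu> i" using mem[of i j] assms(3) by auto
  show "i' \<noteq> i \<Longrightarrow> row_len ?\<Lambda> i' = row_len \<nu> i'" by (simp add: row_len_def)
  show "row_len ?\<Lambda> i = j"
  proof (rule ccontr)
    assume "row_len ?\<Lambda> i \<noteq> j"
    then have "(i, Suc j) \<in> ?\<Lambda>" using j unfolding mem(2) by simp
    then have "(i, Suc j) \<in> \<nu>" by simp
    then show False using j mem(1) by simp
  qed
  show "row_len \<nu> i = j - 1"
  proof (rule ccontr)
    assume "row_len \<nu> i \<noteq> j - 1"
    then have "(i, j - 1) \<notin> \<nu>" "1 \<le> j - 1" using j mem(1)[of i "j - 1"] by auto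
    then show False using j mem(2)[of i "j - 1"] by auto
  qed
qed

text \<open>The end of the row of \<open>x\<close> moves one step to the right and trades places
  with the horizontal edge that followed it on the boundary.\<close>

lemma zero_one_insert:
  assumes "young_diagram \<nu>" "young_diagram (insert x \<nu>)" "x \<notin> \<nu>"
  shows "zero_one \<nu> (content x - 1) = 0" "zero_one \<nu> (content x) = 1"
    "zero_one (insert x \<nu>) = (zero_one \<nu>)(content x - 1 := 1, content x := 0)"
proof -
  obtain i j where x: "x = (i, j)" by fastforce
  note row = row_len_insert[OF assms(1) assms(2)[unfolded x] assms(3)[unfolded x]]
  have ij: "1 \<le> i" "1 \<le> j" using young_diagram_pos[OF assms(2), of i j] x by auto
  let ?f = "\<lambda>i. int (row_len \<nu> i) - int i" and ?g = "\<lambda>i. int (row_len (insert x \<nu>) i) - int i"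
  have f: "?f i = content x - 1" and g: "?g i = content x"
    using row(1,2) ij by (simp_all add: x content_def)
  have fg: "?g i' = ?f i'" if "i' \<noteq> i" for i' using row(3)[OF that] by (simp add: x)
  have f_eq: "?f i' = content x - 1 \<longleftrightarrow> i' = i" if "1 \<le> i'" for i'
    using row_len_minus_eq_iff[OF assms(1) that ij(1)] f by metis
  have g_eq: "?g i' = content x \<longleftrightarrow> i' = i" if "1 \<le> i'" for i'
    using row_len_minus_eq_iff[OF assms(2) that ij(1)] g by metis
  show "zero_one \<nu> (content x - 1) = 0" using f ij unfolding zero_one_eq_0_iff by metis
  have "?f i' \<noteq> content x" if "1 \<le> i'" for i'
    using f g_eq[OF that] fg[of i'] by (cases "i' = i") auto
  then show "zero_one \<nu> (content x) = 1" unfolding zero_one_neq_0_iff[symmetric] zero_one_eq_0_iff by metis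
  have "?g i' \<noteq> content x - 1" if "1 \<le> i'" for i'
    using g f_eq[OF that] fg[of i'] by (cases "i' = i") auto
  then have 1: "zero_one (insert x \<nu>) (content x - 1) = 1"
    unfolding zero_one_neq_0_iff[symmetric] zero_one_eq_0_iff by metis
  have 2: "zero_one (insert x \<nu>) (content x) = 0" using g ij unfolding zero_one_eq_0_iff by metis
  have 3: "zero_one (insert x \<nu>) m = zero_one \<nu> m" if "m \<noteq> content x - 1" "m \<noteq> content x" for m
  proof -
    have "(\<exists>i'\<ge>1. m = ?g i') \<longleftrightarrow> (\<exists>i'\<ge>1. m = ?f i')"
      using that f g fg by metis
    then show ?thesis by (simp add: zero_one_def)
  qed
  show "zero_one (insert x \<nu>) = (zero_one \<nu>)(content x - 1 := 1, content x := 0)"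
    using 1 2 3 by (intro ext) auto
qed

lemma add_box:
  assumes "young_diagram \<nu>" "zero_one \<nu> (c - 1) = 0" "zero_one \<nu> c = 1"
  obtains x where "x \<notin> \<nu>" "young_diagram (insert x \<nu>)" "content x = c"
    "zero_one (insert x \<nu>) = (zero_one \<nu>)(c - 1 := 1, c := 0)"
proof -
  note mem = young_diagram_mem_iff[OF assms(1)]
  obtain i where i: "1 \<le> i" "c - 1 = int (row_len \<nu> i) - int i"
    using assms(2) zero_one_eq_0_iff by blast
  let ?j = "Suc (row_len \<nu> i)"
  have above: "?j \<le> row_len \<nu> i'" if "1 \<le> i'" "i' < i" for i'
  proof -
    have "row_len \<nu> (i - 1) \<le> row_len \<nu> i'"
      using row_len_antimono[OF assms(1) that(1), of "i - 1"] that by simp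
    \<comment> \<open>If row \<open>i - 1\<close> were only as long as row \<open>i\<close>, its
      vertical edge would sit at \<open>c\<close>, but \<open>c\<close> carries a one.\<close>
    moreover have "c \<noteq> int (row_len \<nu> (i - 1)) - int (i - 1)"
      proof -
      have "1 \<le> i - 1" "zero_one \<nu> c \<noteq> 0" using assms(3) that by auto
      then show ?thesis unfolding zero_one_eq_0_iff by blast
    qed
    moreover have "row_len \<nu> i \<le> row_len \<nu> (i - 1)"
      using row_len_antimono[OF assms(1), of "i - 1" i] that by simp
    ultimately show ?thesis using i that by (simp add: of_nat_diff)
  qed
  have young: "young_diagram (insert (i, ?j) \<nu>)"
  proof (rule young_diagramI)
    show "finite (insert (i, ?j) \<nu>)" using young_diagram_finite[OF assms(1)] by simp
    fix a b assume ab: "(a, b) \<in> insert (i, ?j) \<nu>"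
    then show "1 \<le> a" "1 \<le> b" using i(1) young_diagram_pos[OF assms(1), of a b] by auto
    fix a' b' assume *: "1 \<le> a'" "a' \<le> a" "1 \<le> b'" "b' \<le> b"
    show "(a', b') \<in> insert (i, ?j) \<nu>"
    proof (cases "(a, b) \<in> \<nu>")
      case True
      then show ?thesis using young_diagram_down[OF assms(1) _ *] by simp
    next
      case False
      then have "a = i" "b = ?j" using ab by simp_all
      then show ?thesis using * above[of a'] mem[of a' b'] by (cases "a' < i") auto
    qed
  qed
  moreover have "(i, ?j) \<notin> \<nu>" using mem by simp
  moreover have "content (i, ?j) = c" using i by (simp add: content_def)
  ultimately show thesis using that zero_one_insert(3)[OF assms(1)] by metis
qed

text \<open>A box with maximal sum of row and column index can be removed, since no other box lies
  weakly below and to the right of it.\<close>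

lemma young_diagram_induct [consumes 1, case_names empty insert]:
  assumes "young_diagram \<Lambda>" and "P {}"
    and insert: "\<And>x \<nu>. young_diagram \<nu> \<Longrightarrow> young_diagram (insert x \<nu>) \<Longrightarrow> x \<notin> \<nu> \<Longrightarrow> P \<nu> \<Longrightarrow> P (insert x \<nu>)"
  shows "P \<Lambda>"
  using assms(1)
proof (induction "card \<Lambda>" arbitrary: \<Lambda>)
  case 0
  then show ?case using assms(2) young_diagram_finite by force
next
  case (Suc n)
  have fin: "finite \<Lambda>" using Suc young_diagram_finite by blast
  moreover have "\<Lambda> \<noteq> {}" using Suc by auto
  ultimately have "Max ((\<lambda>y. fst y + snd y) ` \<Lambda>) \<in> (\<lambda>y. fst y + snd y) ` \<Lambda>" by simp
  then obtain x where x': "x \<in> \<Lambda>" "fst x + snd x = Max ((\<lambda>y. fst y + snd y) ` \<Lambda>)" by force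
  have x: "x \<in> \<Lambda>" "\<And>y. y \<in> \<Lambda> \<Longrightarrow> fst y + snd y \<le> fst x + snd x"
    unfolding x'(2) using fin x'(1) by simp_all
  have "young_diagram (\<Lambda> - {x})"
  proof (rule young_diagramI)
    show "finite (\<Lambda> - {x})" using fin by simp
    fix i j assume y: "(i, j) \<in> \<Lambda> - {x}"
    then show "1 \<le> i" "1 \<le> j" using young_diagram_pos[OF Suc.prems, of i j] by simp_all
    fix i' j' assume *: "1 \<le> i'" "i' \<le> i" "1 \<le> j'" "j' \<le> j"
    then have "(i', j') \<noteq> x" using x(2)[of "(i, j)"] y by auto
    then show "(i', j') \<in> \<Lambda> - {x}" using young_diagram_down[OF Suc.prems _ *] y by simp
  qed
  moreover have "card (\<Lambda> - {x}) = n" using Suc(2) x(1) fin by simp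
  ultimately have "P (insert x (\<Lambda> - {x}))"
    using Suc x(1) by (intro insert) (auto simp: insert_absorb)
  then show ?case using x(1) by (simp add: insert_absorb)
qed

subsection \<open>Contents and $q_3$\<close>

lemma removable_iff:
  assumes "young_diagram \<nu>"
  shows "(i, j) \<in> removable \<nu> \<longleftrightarrow> 1 \<le> i \<and> 1 \<le> j \<and> row_len \<nu> i = j \<and> row_len \<nu> (Suc i) < j"
proof
  assume "(i, j) \<in> removable \<nu>"
  then have x: "(i, j) \<in> \<nu>" "young_diagram (\<nu> - {(i, j)})" by (simp_all add: removable_def)
  have ins: "insert (i, j) (\<nu> - {(i, j)}) = \<nu>" using x(1) by blast
  have "row_len \<nu> i = j" using row_len_insert(2)[OF x(2), of i j] assms unfolding ins by simp
  moreover have "(Suc i, j) \<notin> \<nu>"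
    using young_diagram_down[OF x(2), of "Suc i" j i j] young_diagram_pos[OF assms x(1)] by auto
  ultimately show "1 \<le> i \<and> 1 \<le> j \<and> row_len \<nu> i = j \<and> row_len \<nu> (Suc i) < j"
    using young_diagram_pos[OF assms x(1)] young_diagram_mem_iff[OF assms, of "Suc i" j] by simp
next
  assume *: "1 \<le> i \<and> 1 \<le> j \<and> row_len \<nu> i = j \<and> row_len \<nu> (Suc i) < j"
  then have mem: "(i, j) \<in> \<nu>" using young_diagram_mem_iff[OF assms] by simp
  have "young_diagram (\<nu> - {(i, j)})"
  proof (rule young_diagramI)
    show "finite (\<nu> - {(i, j)})" using young_diagram_finite[OF assms] by simp
    fix a b assume ab: "(a, b) \<in> \<nu> - {(i, j)}"
    then show "1 \<le> a" "1 \<le> b" using young_diagram_pos[OF assms, of a b] by simp_all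
    fix a' b' assume le: "1 \<le> a'" "a' \<le> a" "1 \<le> b'" "b' \<le> b"
    have b: "b \<le> row_len \<nu> a" using ab young_diagram_mem_iff[OF assms, of a b] by simp
    have "(a', b') \<noteq> (i, j)"
    proof
      assume "(a', b') = (i, j)"
      then have "i \<le> a" "j \<le> b" using le by simp_all
      show False
      proof (cases "a = i")
        case True
        then show False using b * ab \<open>j \<le> b\<close> by simp
      next
        case False
        then have "row_len \<nu> a \<le> row_len \<nu> (Suc i)"
          using row_len_antimono[OF assms, of "Suc i" a] \<open>i \<le> a\<close> by simp
        then show False using b * \<open>j \<le> b\<close> by simp
      qed
    qed
    then show "(a', b') \<in> \<nu> - {(i, j)}" using young_diagram_down[OF assms _ le] ab by simp
  qed
  with mem show "(i, j) \<in> removable \<nu>" by (simp add: removable_def)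
qed

text \<open>The last row that is still as long as row \<open>r\<close> ends in a removable box. This
  rules out a change of row length between consecutive corners.\<close>

lemma removable_between:
  assumes "young_diagram \<nu>" "1 \<le> r" "r < s" "row_len \<nu> s < row_len \<nu> r"
  obtains r' where "r \<le> r'" "r' < s" "(r', row_len \<nu> r') \<in> removable \<nu>"
proof -
  let ?P = "\<lambda>u. row_len \<nu> (r + u) < row_len \<nu> r"
  define u where "u = (LEAST u. ?P u)"
  have P: "?P (s - r)" using assms by simp
  then have "?P u" unfolding u_def by (rule LeastI)
  then have "u \<noteq> 0" by (cases u) simp_all
  then obtain v where v: "u = Suc v" by (cases u) simp_all
  have "\<not> ?P v" using not_less_Least[of v ?P] v by (simp add: u_def)
  then have "row_len \<nu> (r + v) = row_len \<nu> r"
    using row_len_antimono[OF assms(1,2), of "r + v"] by simp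
  then have "(r + v, row_len \<nu> (r + v)) \<in> removable \<nu>"
    using \<open>?P u\<close> assms(2) by (simp add: removable_iff[OF assms(1)] v)
  moreover have "u \<le> s - r" unfolding u_def using P by (rule Least_le)
  ultimately show thesis using that[of "r + v"] v by simp
qed

text \<open>The key \<open>fst\<close> is injective on the removable boxes but not on all pairs, so
  the locale is interpreted with \<open>S\<close> as carrier.\<close>

lemma (in linorder) sorted_key_list_of_set_inj_on:
  assumes "inj_on f S" "finite S"
  shows "set (sorted_key_list_of_set f S) = S" "sorted_wrt (<) (map f (sorted_key_list_of_set f S))"
proof -
  interpret folding_insort_key "(\<le>)" "(<)" S f
    by unfold_locales (rule assms(1))
  show "set (sorted_key_list_of_set f S) = S"
    by (rule set_sorted_key_list_of_set[OF subset_refl assms(2)])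
  show "sorted_wrt (<) (map f (sorted_key_list_of_set f S))"
    by (rule strict_sorted_key_list_of_set[OF subset_refl])
qed

lemma corners_props:
  assumes "young_diagram \<nu>"
  shows "set (corners \<nu>) = removable \<nu>" "sorted_wrt (>) (map fst (corners \<nu>))"
proof -
  have fin: "finite (removable \<nu>)"
    using young_diagram_finite[OF assms] by (simp add: removable_def)
  have "inj_on fst (removable \<nu>)"
  proof (rule inj_onI)
    fix x y assume "x \<in> removable \<nu>" "y \<in> removable \<nu>" "fst x = fst y"
    moreover have "snd z = row_len \<nu> (fst z)" if "z \<in> removable \<nu>" for z
      using that removable_iff[OF assms, of "fst z" "snd z"] by simp
    ultimately show "x = y" by (simp add: prod_eq_iff)
  qed
  from sorted_key_list_of_set_inj_on[OF this fin] show "set (corners \<nu>) = removable \<nu>"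
    "sorted_wrt (>) (map fst (corners \<nu>))"
    by (simp_all add: corners_def rev_map[symmetric] sorted_wrt_rev)
qed

lemma sum_telescope_down: "(\<Sum>l=1..m. g l - g (Suc l)) = (g 1 - g (Suc m) :: int)"
  by (induction m) simp_all

text \<open>The contents in row \<open>r\<close> are the consecutive integers from
  \<open>1 - r\<close> to \<open>row_len \<nu> r - r\<close>, so every row telescopes.\<close>

lemma sum_boxes_by_rows:
  fixes F :: "int \<Rightarrow> int"
  assumes "young_diagram \<nu>" "\<And>r. R < r \<Longrightarrow> row_len \<nu> r = 0"
  shows "(\<Sum>x\<in>\<nu>. F (content x) - F (content x - 1))
    = (\<Sum>r=1..R. F (int (row_len \<nu> r) - int r) - F (- int r))"
proof -
  have \<nu>: "\<nu> = Sigma {1..R} (\<lambda>r. {1..row_len \<nu> r})"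
  proof (rule set_eqI)
    fix x :: "nat \<times> nat"
    obtain i j where x: "x = (i, j)" by fastforce
    have "i \<le> R" if "(i, j) \<in> \<nu>"
      using that assms(2)[of i] young_diagram_mem_iff[OF assms(1), of i j] by (cases "R < i") auto
    then show "x \<in> \<nu> \<longleftrightarrow> x \<in> Sigma {1..R} (\<lambda>r. {1..row_len \<nu> r})"
      using young_diagram_mem_iff[OF assms(1), of i j] young_diagram_pos(1)[OF assms(1), of i j]
      unfolding x by auto
  qed
  have "(\<Sum>j=1..n. F (int j - int r) - F (int j - int r - 1)) = F (int n - int r) - F (- int r)" for n r
    by (induction n) (simp_all add: algebra_simps)
  moreover have "(\<Sum>x\<in>\<nu>. F (content x) - F (content x - 1))
    = (\<Sum>r=1..R. \<Sum>j=1..row_len \<nu> r. F (int j - int r) - F (int j - int r - 1))"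
    by (subst \<nu>, subst sum.Sigma) (auto simp: content_def case_prod_beta)
  ultimately show ?thesis by simp
qed

text \<open>The addable and the removable box at the two ends of a run of rows of equal length are
  paired; the difference of the cubes of their contents telescopes along the run.\<close>

lemma q3_eq_sum_content:
  assumes "young_diagram \<nu>"
  shows "q3 \<nu> = 6 * (\<Sum>x\<in>\<nu>. content x)"
proof -
  define m where "m = length (corners \<nu>)"
  \<comment> \<open>The corner rows as natural numbers, with the convention
    \<open>a (Suc m) = 0\<close> built in. For the empty diagram it yields \<open>a 1 = 0\<close>,
    so this case needs no separate treatment.\<close>
  define a where "a l = (if l = Suc m then 0 else fst (corners \<nu> ! (l - 1)))" for l
  have row: "corner_row \<nu> l = int (a l)" for l
    by (simp add: corner_row_def a_def m_def)
  have nth: "(a l, row_len \<nu> (a l)) \<in> removable \<nu>" "corner_col \<nu> l = int (row_len \<nu> (a l))"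
    if "1 \<le> l" "l \<le> m" for l
  proof -
    obtain i j where ij: "corners \<nu> ! (l - 1) = (i, j)" by fastforce
    have "corners \<nu> ! (l - 1) \<in> set (corners \<nu>)" using that by (intro nth_mem) (simp add: m_def)
    then have "(i, j) \<in> removable \<nu>" using corners_props[OF assms] ij by simp
    moreover have "a l = i" using that ij by (simp add: a_def)
    moreover have "row_len \<nu> i = j" using calculation(1) removable_iff[OF assms] by blast
    ultimately show "(a l, row_len \<nu> (a l)) \<in> removable \<nu>" "corner_col \<nu> l = int (row_len \<nu> (a l))"
      using that ij by (simp_all add: corner_col_def)
  qed
  have pos: "0 < a l" if "1 \<le> l" "l \<le> m" for l
    using nth(1)[OF that] removable_iff[OF assms, of "a l"] by simp
  have mono: "a l' < a l" if "1 \<le> l" "l < l'" "l' \<le> Suc m" for l l'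
  proof (cases "l' = Suc m")
    case True
    then show ?thesis using pos[of l] that by (simp add: a_def)
  next
    case False
    then show ?thesis
      using sorted_wrt_nth_less[OF corners_props(2)[OF assms], of "l - 1" "l' - 1"] that
      by (simp add: a_def m_def)
  qed
  have index: "\<exists>l. 1 \<le> l \<and> l \<le> m \<and> r = a l" if "(r, c) \<in> removable \<nu>" for r c
  proof -
    have "(r, c) \<in> set (corners \<nu>)" using that corners_props(1)[OF assms] by simp
    then obtain l where "l < m" "corners \<nu> ! l = (r, c)" unfolding m_def in_set_conv_nth by blast
    then have "1 \<le> Suc l \<and> Suc l \<le> m \<and> r = a (Suc l)" by (simp add: a_def)
    then show ?thesis by blast
  qed
  \<comment> \<open>A drop in row length inside this range would produce a corner strictly between
    two consecutive corner rows.\<close>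
  have block: "row_len \<nu> r = row_len \<nu> (a l)" if "1 \<le> l" "l \<le> m" "a (Suc l) < r" "r \<le> a l" for l r
  proof (rule ccontr)
    assume neq: "row_len \<nu> r \<noteq> row_len \<nu> (a l)"
    have "1 \<le> r" using that by simp
    moreover have "row_len \<nu> (a l) < row_len \<nu> r"
      using row_len_antimono[OF assms \<open>1 \<le> r\<close> that(4)] neq by simp
    moreover have "r < a l" using that(4) neq by (cases "r = a l") simp_all
    ultimately obtain r' where "r \<le> r'" "r' < a l" "(r', row_len \<nu> r') \<in> removable \<nu>"
      using removable_between[OF assms] by blast
    moreover have "a (Suc l) < r'" using that(3) calculation(1) by simp
    ultimately obtain l' where l': "1 \<le> l'" "l' \<le> m" "a (Suc l) < a l'" "a l' < a l"
      using index[of r'] by blast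
    consider "l' < l" | "l' = l" | "l' = Suc l" | "Suc l < l'" by linarith
    then show False
      using mono[of l' l] mono[of "Suc l" l'] l' that(1,2) by cases auto
  qed
  \<comment> \<open>\<open>a 1\<close> is the lowest corner row; a non-empty row below it would
    force a further corner.\<close>
  have zero: "row_len \<nu> r = 0" if "a 1 < r" for r
  proof (rule ccontr)
    assume neq: "row_len \<nu> r \<noteq> 0"
    obtain N where "\<forall>i>N. row_len \<nu> i = 0"
      using row_len_eventually_0[OF assms] by blast
    then have "row_len \<nu> (Suc (N + r)) < row_len \<nu> r" using neq by simp
    moreover have "1 \<le> r" "r < Suc (N + r)" using that by simp_all
    ultimately obtain r' where "r \<le> r'" "(r', row_len \<nu> r') \<in> removable \<nu>"
      using removable_between[OF assms] by blast
    moreover have "a 1 < r'" using that calculation(1) by simp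
    ultimately obtain l' where l': "1 \<le> l'" "l' \<le> m" "a 1 < a l'"
      using index[of r'] by blast
    then show False using mono[of 1 l'] by (cases "l' = 1") auto
  qed
  \<comment> \<open>The difference of cubes has the difference
    \<open>F x - F (x - 1) = 6 * x\<close>, the source of the factor 6.\<close>
  define F :: "int \<Rightarrow> int" where "F x = (x + 1) ^ 3 - x ^ 3" for x
  define G where "G u = (\<Sum>r=1..u. F (int (row_len \<nu> r) - int r))" for u
  have G_block: "G u' - G u = (int b - int u) ^ 3 - (int b - int u') ^ 3"
    if "u \<le> u'" "\<And>r. u < r \<Longrightarrow> r \<le> u' \<Longrightarrow> row_len \<nu> r = b" for u u' b
    using that
  proof (induction u' rule: dec_induct)
    case base
    then show ?case by simp
  next
    case (step v)
    have "row_len \<nu> (Suc v) = b" using step by simp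
    then have "G (Suc v) = G v + F (int b - int (Suc v))" by (simp add: G_def)
    moreover have "F (int b - int (Suc v)) = (int b - int v) ^ 3 - (int b - int (Suc v)) ^ 3"
      by (simp add: F_def)
    ultimately show ?case using step by simp
  qed
  \<comment> \<open>The term l = 0 of \<open>q3\<close> is minus the cube of the number of non-empty
    rows. Expanded like this, it supplies the left ends of all rows in
    \<open>sum_boxes_by_rows\<close>.\<close>
  have "(- int u) ^ 3 = - (\<Sum>r=1..u. F (- int r))" for u
    by (induction u) (simp_all add: F_def power3_eq_cube algebra_simps)
  then have first: "(corner_col \<nu> 0 - corner_row \<nu> 1) ^ 3 = - (\<Sum>r=1..a 1. F (- int r))"
    using row[of 1] by (simp add: corner_col_def)
  have "(\<Sum>l=1..m. (corner_col \<nu> l - corner_row \<nu> (Suc l)) ^ 3 - (corner_col \<nu> l - corner_row \<nu> l) ^ 3)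
    = (\<Sum>l=1..m. G (a l) - G (a (Suc l)))"
  proof (rule sum.cong[OF refl])
    fix l assume "l \<in> {1..m}"
    then have l: "1 \<le> l" "l \<le> m" by simp_all
    have "a (Suc l) \<le> a l" using mono[of l "Suc l"] l by simp
    from G_block[OF this block[OF l]]
    show "(corner_col \<nu> l - corner_row \<nu> (Suc l)) ^ 3 - (corner_col \<nu> l - corner_row \<nu> l) ^ 3
      = G (a l) - G (a (Suc l))"
      by (simp add: row nth(2)[OF l])
  qed
  also have "\<dots> = G (a 1)"
    using sum_telescope_down[of "\<lambda>l. G (a l)" m] by (simp add: a_def G_def)
  finally have rest: "(\<Sum>l=1..m. (corner_col \<nu> l - corner_row \<nu> (Suc l)) ^ 3 - (corner_col \<nu> l - corner_row \<nu> l) ^ 3)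
    = G (a 1)" .
  have "q3 \<nu> = (\<Sum>l=0..m. (corner_col \<nu> l - corner_row \<nu> (Suc l)) ^ 3)
      - (\<Sum>l=1..m. (corner_col \<nu> l - corner_row \<nu> l) ^ 3)"
    by (simp add: q3_def m_def Let_def)
  also have "\<dots> = (corner_col \<nu> 0 - corner_row \<nu> 1) ^ 3 + G (a 1)"
    unfolding rest[symmetric] sum_subtractf by (simp add: sum.atLeast_Suc_atMost)
  also have "\<dots> = (\<Sum>r=1..a 1. F (int (row_len \<nu> r) - int r) - F (- int r))"
    unfolding first G_def sum_subtractf by simp
  also have "\<dots> = (\<Sum>x\<in>\<nu>. F (content x) - F (content x - 1))"
    using sum_boxes_by_rows[OF assms zero] by simp
  also have "\<dots> = (\<Sum>x\<in>\<nu>. 6 * content x)"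
    by (rule sum.cong) (simp_all add: F_def power3_eq_cube algebra_simps)
  finally show ?thesis by (simp add: sum_distrib_left)
qed

section \<open>Content sums read off the 01-sequence\<close>

lemma zero_one_empty: "zero_one {} m = (if m < 0 then 0 else 1)"
proof -
  have "(\<exists>i\<ge>1. m = int (row_len {} i) - int i) \<longleftrightarrow> m < 0"
  proof
    assume "m < 0"
    then have "1 \<le> nat (- m)" "m = int (row_len {} (nat (- m))) - int (nat (- m))"
      by (simp_all add: row_len_def)
    then show "\<exists>i\<ge>1. m = int (row_len {} i) - int i" by blast
  qed (auto simp: row_len_def)
  then show ?thesis by (simp add: zero_one_def)
qed

lemma sum_delta_diff:
  fixes f :: "int \<Rightarrow> int"
  assumes "finite S" "p \<in> S" "q \<in> S"
  shows "(\<Sum>x\<in>S. ((if x = p then 1 else 0) - (if x = q then 1 else 0)) * f x) = f p - f q"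
proof -
  have "(\<Sum>x\<in>S. ((if x = p then 1 else 0) - (if x = q then 1 else 0)) * f x)
    = (\<Sum>x\<in>S. (if x = p then f x else 0) - (if x = q then f x else 0))"
    by (rule sum.cong) auto
  then show ?thesis using assms by (simp add: sum_subtractf)
qed

text \<open>The right-hand side weighs the deviation from the sequence of the empty diagram. A new
  box of content \<open>c\<close> moves a zero from \<open>c - 1\<close> to \<open>c\<close>, so
  both sides grow by \<open>F c - F (c - 1)\<close>. Three choices of \<open>F\<close> are used
  later: a constant (balance), an antidifference of a function of the content, and an affine
  function (number of boxes).\<close>

lemma sum_boxes_eq_sum_zero_one:
  fixes F :: "int \<Rightarrow> int"
  assumes "young_diagram \<Lambda>" "\<And>m. m < A \<Longrightarrow> zero_one \<Lambda> m = 0" "\<And>m. B \<le> m \<Longrightarrow> zero_one \<Lambda> m = 1"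
  shows "(\<Sum>x\<in>\<Lambda>. F (content x) - F (content x - 1))
    = (\<Sum>m\<in>{A..<B}. ((if 0 \<le> m then 1 else 0) - int (zero_one \<Lambda> m)) * F m)"
  using assms
proof (induction rule: young_diagram_induct)
  case empty
  have "(\<Sum>m\<in>{A..<B}. ((if 0 \<le> m then 1 else 0) - int (zero_one {} m)) * F m) = 0"
    by (rule sum.neutral) (simp add: zero_one_empty)
  then show ?case by simp
next
  case (insert x \<nu>)
  note z = zero_one_insert[OF insert.hyps]
  define c where "c = content x"
  have z': "zero_one (insert x \<nu>) m = (if m = c then 0 else if m = c - 1 then 1 else zero_one \<nu> m)" for m
    unfolding z(3) by (simp add: c_def)
  \<comment> \<open>In the larger diagram \<open>c - 1\<close> carries a one and \<open>c\<close> a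
    zero, so both lie in the window; hence the window also serves the smaller diagram.\<close>
  have "A \<le> c - 1" using insert.prems(1)[of "c - 1"] z'[of "c - 1"] by fastforce
  moreover have "c < B" using insert.prems(2)[of c] z'[of c] by fastforce
  ultimately have AB: "c \<in> {A..<B}" "c - 1 \<in> {A..<B}" by simp_all
  have "zero_one \<nu> m = 0" if "m < A" for m
    using insert.prems(1)[OF that] z'[of m] that AB by (auto split: if_splits)
  moreover have "zero_one \<nu> m = 1" if "B \<le> m" for m
    using insert.prems(2)[OF that] z'[of m] that AB by (auto split: if_splits)
  ultimately have IH: "(\<Sum>y\<in>\<nu>. F (content y) - F (content y - 1))
    = (\<Sum>m\<in>{A..<B}. ((if 0 \<le> m then 1 else 0) - int (zero_one \<nu> m)) * F m)"
    by (rule insert.IH)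
  have "(\<Sum>m\<in>{A..<B}. ((if 0 \<le> m then 1 else 0) - int (zero_one (insert x \<nu>) m)) * F m)
    - (\<Sum>m\<in>{A..<B}. ((if 0 \<le> m then 1 else 0) - int (zero_one \<nu> m)) * F m)
    = (\<Sum>m\<in>{A..<B}. ((if m = c then 1 else 0) - (if m = c - 1 then 1 else 0)) * F m)"
    unfolding sum_subtractf[symmetric] using z(1,2)
    by (intro sum.cong) (simp_all add: z' c_def[symmetric])
  also have "\<dots> = F c - F (c - 1)"
    by (rule sum_delta_diff[OF _ AB]) simp
  finally show ?case
    using IH insert.hyps(3) young_diagram_finite[OF insert.hyps(1)] by (simp add: c_def)
qed

section \<open>Recovering a diagram from a shifted sequence\<close>

lemma zero_one_inject:
  assumes "young_diagram \<Lambda>" "young_diagram M" "zero_one \<Lambda> = zero_one M"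
  shows "\<Lambda> = M"
proof -
  have eq: "(\<exists>i\<ge>1. m = int (row_len \<Lambda> i) - int i) \<longleftrightarrow> (\<exists>i\<ge>1. m = int (row_len M i) - int i)" for m
    using assms(3) zero_one_eq_0_iff by metis
  \<comment> \<open>Both diagrams list the same zeros in decreasing order, so the rows agree from
    the top down. The inequality is stated for arbitrary diagrams in order to be used in both
    directions.\<close>
  have le: "row_len \<Lambda>1 i \<le> row_len \<Lambda>2 i"
    if "young_diagram \<Lambda>1" "young_diagram \<Lambda>2" "1 \<le> i"
      "\<And>m. (\<exists>i\<ge>1. m = int (row_len \<Lambda>1 i) - int i) \<longleftrightarrow> (\<exists>i\<ge>1. m = int (row_len \<Lambda>2 i) - int i)"
      "\<And>i'. 1 \<le> i' \<Longrightarrow> i' < i \<Longrightarrow> row_len \<Lambda>1 i' = row_len \<Lambda>2 i'" for \<Lambda>1 \<Lambda>2 i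
  proof -
    have "\<exists>i'\<ge>1. int (row_len \<Lambda>1 i) - int i = int (row_len \<Lambda>2 i') - int i'"
      using that(3,4) by blast
    then obtain i' where i': "1 \<le> i'" "int (row_len \<Lambda>1 i) - int i = int (row_len \<Lambda>2 i') - int i'"
      by blast
    have "\<not> i' < i"
      using that(5)[of i'] row_len_minus_eq_iff[OF that(1,3) i'(1)] i' by fastforce
    then have "row_len \<Lambda>2 i' \<le> row_len \<Lambda>2 i" using row_len_antimono[OF that(2,3)] by simp
    then show ?thesis using i' \<open>\<not> i' < i\<close> by linarith
  qed
  have row: "row_len \<Lambda> i = row_len M i" if "1 \<le> i" for i
    using that
  proof (induction i rule: less_induct)
    case (less i)
    then show ?case using le[OF assms(1,2), of i] le[OF assms(2,1), of i] eq by (simp add: le_antisym)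
  qed
  have "(i, j) \<in> \<Lambda> \<longleftrightarrow> (i, j) \<in> M" for i j
    using young_diagram_mem_iff[OF assms(1), of i j] young_diagram_mem_iff[OF assms(2), of i j]
      young_diagram_pos(1)[OF assms(1), of i j] young_diagram_pos(1)[OF assms(2), of i j] row[of i]
    by auto
  then show ?thesis by auto
qed

lemma sum_nonneg_indicator:
  fixes A B :: int
  assumes "A \<le> 0" "0 \<le> B"
  shows "(\<Sum>m\<in>{A..<B}. if 0 \<le> m then 1 else 0) = B"
proof -
  have "(\<Sum>m\<in>{A..<B}. if 0 \<le> m then 1 else 0) = (\<Sum>m\<in>{0..<B}. 1 :: int)"
    using assms by (intro sum.mono_neutral_cong_right) auto
  then show ?thesis using assms by simp
qed

text \<open>Balance fixes the shift. For \<open>L\<close> large enough the positions from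
  \<open>-L\<close> to \<open>L - 1\<close> of \<open>M\<close> carry \<open>L\<close> ones, while
  the corresponding positions of \<open>\<Lambda>\<close>, shifted by \<open>s\<close>, carry
  \<open>L + s\<close>; these are the same values.\<close>

lemma zero_one_inject_shift:
  assumes "young_diagram \<Lambda>" "young_diagram M" "\<And>j. zero_one \<Lambda> (j + s) = zero_one M j"
  shows "s = 0" "\<Lambda> = M"
proof -
  obtain K where K: "0 \<le> K" "\<And>m. m < - K \<Longrightarrow> zero_one \<Lambda> m = 0" "\<And>m. K \<le> m \<Longrightarrow> zero_one \<Lambda> m = 1"
    by (rule zero_one_bounds[OF assms(1)]) blast
  define L where "L = K + \<bar>s\<bar>"
  have "(\<Sum>m\<in>{-L+s..<L+s}. ((if 0 \<le> m then 1 else 0) - int (zero_one \<Lambda> m)) * 1) = 0"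
    using sum_boxes_eq_sum_zero_one[OF assms(1), of "-L+s" "L+s" "\<lambda>_. 1"] K by (simp add: L_def)
  then have 1: "(\<Sum>m\<in>{-L+s..<L+s}. int (zero_one \<Lambda> m)) = L + s"
    using sum_nonneg_indicator[of "-L+s" "L+s"] K by (simp add: sum_subtractf L_def)
  have M: "zero_one M m = 0" if "m < - L" for m
    using assms(3)[of m] K(2)[of "m + s"] that by (simp add: L_def)
  have M': "zero_one M m = 1" if "L \<le> m" for m
    using assms(3)[of m] K(3)[of "m + s"] that by (simp add: L_def)
  have "(\<Sum>m\<in>{-L..<L}. ((if 0 \<le> m then 1 else 0) - int (zero_one M m)) * 1) = 0"
    using sum_boxes_eq_sum_zero_one[OF assms(2) M M', where F = "\<lambda>_. 1"] by simp
  then have 2: "(\<Sum>m\<in>{-L..<L}. int (zero_one M m)) = L"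
    using sum_nonneg_indicator[of "-L" "L"] K by (simp add: sum_subtractf L_def)
  have "(\<Sum>m\<in>{-L+s..<L+s}. int (zero_one \<Lambda> m)) = (\<Sum>m\<in>{-L..<L}. int (zero_one \<Lambda> (m + s)))"
    by (rule sum.reindex_bij_witness[of _ "\<lambda>m. m + s" "\<lambda>m. m - s"]) auto
  then show "s = 0" using 1 2 by (simp add: assms(3))
  then show "\<Lambda> = M" using assms by (intro zero_one_inject) auto
qed

text \<open>Reduces the \<open>THE\<close> to one witness with any shift: by
  \<open>zero_one_inject_shift\<close> no second diagram fits, whatever its own shift.\<close>

lemma t_quotient_eqI:
  assumes "young_diagram \<nu>" "\<And>j. zero_one \<nu> (j + s) = zero_one \<Lambda> (int t * j + int i)"
  shows "t_quotient t \<Lambda> i = \<nu>"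
  unfolding t_quotient_def
proof (rule the_equality)
  show "young_diagram \<nu> \<and> (\<exists>s. \<forall>j. zero_one \<nu> (j + s) = zero_one \<Lambda> (int t * j + int i))"
    using assms by blast
  fix M assume M: "young_diagram M \<and> (\<exists>s. \<forall>j. zero_one M (j + s) = zero_one \<Lambda> (int t * j + int i))"
  then obtain s' where s': "\<And>j. zero_one M (j + s') = zero_one \<Lambda> (int t * j + int i)" by blast
  have "zero_one M (j + (s' - s)) = zero_one \<nu> j" for j
    using s'[of "j - s"] assms(2)[of "j - s"] by (simp add: algebra_simps)
  then show "M = \<nu>" using zero_one_inject_shift(2) M assms(1) by blast
qed

subsection \<open>Moving one zero\<close>

text \<open>In a core a one forces a one \<open>t\<close> positions later, so each residue class
  consists of zeros followed by ones, and the step defines \<open>core_d\<close>.\<close>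

lemma core_zero_one:
  assumes "is_core t M" "0 < t" "i < t"
  shows "zero_one M (int t * m + int i) = (if m < core_d t M i then 0 else 1)"
    and "core_b t M i = int t * core_d t M i + int i"
proof -
  let ?z = "\<lambda>m. zero_one M (int t * m + int i)"
  have young: "young_diagram M" using assms(1) by (simp add: is_core_def)
  obtain K where K: "0 \<le> K" "\<And>m. m < - K \<Longrightarrow> zero_one M m = 0" "\<And>m. K \<le> m \<Longrightarrow> zero_one M m = 1"
    by (rule zero_one_bounds[OF young]) blast
  define L where "L = K + int i + 1"
  have low: "?z m = 0" if "m < - L" for m
  proof (rule K(2))
    have "(int t - 1) * m \<le> 0" using that K(1) assms(2) by (simp add: L_def mult_nonneg_nonpos)
    then have "int t * m \<le> m" by (simp add: algebra_simps)
    then show "int t * m + int i < - K" using that by (simp add: L_def)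
  qed
  have high: "?z K = 1"
  proof (rule K(3))
    have "1 * K \<le> int t * K" using K(1) assms(2) by (intro mult_right_mono) simp_all
    then show "K \<le> int t * K + int i" by simp
  qed
  have up: "?z (m + int n) = 1" if "?z m = 1" for m n
  proof (induction n)
    case 0
    then show ?case using that by simp
  next
    case (Suc n)
    then show ?case
      using core_zero_one_step[OF assms(1,2), of "int t * (m + int n) + int i"]
      by (simp add: algebra_simps)
  qed
  \<comment> \<open>The integers are not well-ordered, so the first one is sought by a natural
    number counted from \<open>- L\<close>; before that point the class contains zeros only.\<close>
  define n0 where "n0 = (LEAST n. ?z (int n - L) = 1)"
  define D where "D = int n0 - L"
  have "?z (int (nat (K + L)) - L) = 1" using high K(1) by (simp add: L_def)
  then have D1: "?z D = 1" unfolding D_def n0_def by (rule LeastI)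
  have below: "?z m = 0" if "m < D" for m
  proof (cases "m < - L")
    case False
    then have "nat (m + L) < n0" "m = int (nat (m + L)) - L" using that by (simp_all add: D_def)
    then have "?z m \<noteq> 1" using not_less_Least[of "nat (m + L)" "\<lambda>n. ?z (int n - L) = 1"]
      by (simp add: n0_def)
    then show ?thesis using zero_one_neq_0_iff by blast
  qed (rule low)
  have z: "?z m = (if m < D then 0 else 1)" for m
    using below[of m] up[OF D1, of "nat (m - D)"] by (cases "m < D") simp_all
  have b: "core_b t M i = int t * D + int i"
    unfolding core_b_def
  proof (rule Least_equality)
    show "[int t * D + int i = int i] (mod int t) \<and> zero_one M (int t * D + int i) = 1"
      using D1 by (simp add: cong_def)
    fix y assume y: "[y = int i] (mod int t) \<and> zero_one M y = 1"
    then have "int t dvd y - int i" by (simp add: cong_iff_dvd_diff)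
    then obtain m where m: "y - int i = int t * m" by (rule dvdE)
    then have y': "y = int t * m + int i" by simp
    then have "\<not> m < D" using y z[of m] by auto
    then have "int t * D \<le> int t * m" by (intro mult_left_mono) simp_all
    then show "int t * D + int i \<le> y" using y' by simp
  qed
  then have "core_d t M i = D" using assms(2) by (simp add: core_d_def)
  then show "?z m = (if m < core_d t M i then 0 else 1)" "core_b t M i = int t * core_d t M i + int i"
    using z b by simp_all
qed

text \<open>With 0/1 values the product of z_a and 1 - z_b indicates that a one at \<open>a\<close>
  and a zero at \<open>b\<close> are present. The sum over inversions becomes a quadratic expression
  in the sequence, in which the move of a zero is a change of the vector.\<close>

lemma sum_inversions_eq:
  fixes w :: "int \<Rightarrow> int"
  assumes "\<And>m. m < A \<Longrightarrow> zero_one \<Lambda> m = 0" "\<And>m. B \<le> m \<Longrightarrow> zero_one \<Lambda> m = 1"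
  shows "(\<Sum>(a, b)\<in>{(a, b). a < b \<and> zero_one \<Lambda> a = 1 \<and> zero_one \<Lambda> b = 0}. w (b - a))
    = (\<Sum>a\<in>{A..<B}. \<Sum>b\<in>{A..<B}. int (zero_one \<Lambda> a) * (1 - int (zero_one \<Lambda> b)) * (if a < b then w (b - a) else 0))"
proof -
  let ?I = "{(a, b). a < b \<and> zero_one \<Lambda> a = 1 \<and> zero_one \<Lambda> b = 0}"
  let ?g = "\<lambda>(a, b). int (zero_one \<Lambda> a) * (1 - int (zero_one \<Lambda> b)) * (if a < b then w (b - a) else 0)"
  have sub: "?I \<subseteq> {A..<B} \<times> {A..<B}"
  proof
    fix x assume "x \<in> ?I"
    then obtain a b where x: "x = (a, b)" "a < b" "zero_one \<Lambda> a = 1" "zero_one \<Lambda> b = 0" by blast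
    have "A \<le> a" using assms(1)[of a] x(3) by (cases "A \<le> a") simp_all
    moreover have "b < B" using assms(2)[of b] x(4) by (cases "b < B") simp_all
    ultimately show "x \<in> {A..<B} \<times> {A..<B}" using x(1,2) by simp
  qed
  have "(\<Sum>(a, b)\<in>?I. w (b - a)) = (\<Sum>x\<in>?I. ?g x)"
    by (rule sum.cong) auto
  also have "\<dots> = (\<Sum>x\<in>{A..<B} \<times> {A..<B}. ?g x)"
  proof (rule sum.mono_neutral_left[OF _ sub])
    show "\<forall>x\<in>{A..<B} \<times> {A..<B} - ?I. ?g x = 0"
    proof
      fix x assume "x \<in> {A..<B} \<times> {A..<B} - ?I"
      then obtain a b where x: "x = (a, b)" "\<not> (a < b \<and> zero_one \<Lambda> a = 1 \<and> zero_one \<Lambda> b = 0)"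
        by (cases x) simp
      then show "?g x = 0" using zero_one_neq_0_iff[of \<Lambda> a] zero_one_neq_0_iff[of \<Lambda> b] by auto
    qed
  qed simp
  finally show ?thesis by (simp add: sum.cartesian_product)
qed

text \<open>The new vector is \<open>y - D\<close>, where \<open>D\<close> is the unit vector at
  \<open>p\<close> minus that at \<open>q\<close>. The part quadratic in \<open>D\<close> involves
  \<open>W\<close> only at the points \<open>p\<close> and \<open>q\<close>, where it vanishes; the
  linear part remains.\<close>

lemma sum_move_zero:
  fixes y y' :: "int \<Rightarrow> int" and W :: "int \<Rightarrow> int \<Rightarrow> int"
  assumes "finite S" "p \<in> S" "q \<in> S" "p \<noteq> q" "y p = 1" "y q = 0" "y' = y(p := 0, q := 1)"
    and W: "W p p = 0" "W q q = 0" "W p q = 0" "W q p = 0"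
  shows "(\<Sum>a\<in>S. \<Sum>b\<in>S. y a * (1 - y b) * W a b) - (\<Sum>a\<in>S. \<Sum>b\<in>S. y' a * (1 - y' b) * W a b)
    = (\<Sum>x\<in>S. (1 - y x) * (W p x - W q x) + y x * (W x q - W x p))"
proof -
  define D :: "int \<Rightarrow> int" where "D x = (if x = p then 1 else 0) - (if x = q then 1 else 0)" for x
  have D: "(\<Sum>x\<in>S. D x * f x) = f p - f q" for f
    unfolding D_def by (rule sum_delta_diff[OF assms(1-3)])
  have y': "y' x = y x - D x" for x using assms(4-7) by (simp add: D_def)
  have "(\<Sum>a\<in>S. \<Sum>b\<in>S. y a * (1 - y b) * W a b) - (\<Sum>a\<in>S. \<Sum>b\<in>S. y' a * (1 - y' b) * W a b)
    = (\<Sum>a\<in>S. \<Sum>b\<in>S. (D a * ((1 - y b) * W a b)) - (D b * (y a * W a b)) + D a * (D b * W a b))"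
    unfolding sum_subtractf[symmetric] y' by (intro sum.cong refl) (simp add: algebra_simps)
  also have "\<dots> = (\<Sum>a\<in>S. \<Sum>b\<in>S. D a * ((1 - y b) * W a b)) - (\<Sum>a\<in>S. \<Sum>b\<in>S. D b * (y a * W a b))
      + (\<Sum>a\<in>S. \<Sum>b\<in>S. D a * (D b * W a b))"
    by (simp add: sum.distrib sum_subtractf)
  also have "(\<Sum>a\<in>S. \<Sum>b\<in>S. D a * (D b * W a b)) = 0"
    by (simp add: sum_distrib_left[symmetric] D W)
  also have "(\<Sum>a\<in>S. \<Sum>b\<in>S. D b * (y a * W a b)) = (\<Sum>x\<in>S. y x * (W x p - W x q))"
    by (simp add: D algebra_simps)
  also have "(\<Sum>a\<in>S. \<Sum>b\<in>S. D a * ((1 - y b) * W a b)) = (\<Sum>x\<in>S. (1 - y x) * (W p x - W q x))"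
    by (subst sum.swap) (simp only: D right_diff_distrib)
  finally show ?thesis by (simp add: sum.distrib[symmetric] sum_subtractf[symmetric] algebra_simps)
qed

lemma sum_residue_class:
  fixes g :: "int \<Rightarrow> int"
  assumes "0 < t" "j < t"
  shows "(\<Sum>x\<in>{int t * A..<int t * B}. if [x = int j] (mod int t) then g x else 0)
    = (\<Sum>m\<in>{A..<B}. g (int t * m + int j))"
proof -
  have "(\<Sum>x\<in>{int t * A..<int t * B}. if [x = int j] (mod int t) then g x else 0)
    = (\<Sum>x\<in>{x\<in>{int t * A..<int t * B}. [x = int j] (mod int t)}. g x)"
    by (rule sum.inter_filter[symmetric]) simp
  also have "\<dots> = (\<Sum>m\<in>{A..<B}. g (int t * m + int j))"
  proof (rule sum.reindex_bij_witness[of _ "\<lambda>m. int t * m + int j" "\<lambda>x. x div int t"])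
    fix x assume x: "x \<in> {x\<in>{int t * A..<int t * B}. [x = int j] (mod int t)}"
    then have "x mod int t = int j" using assms by (simp add: cong_def)
    then show "int t * (x div int t) + int j = x" by (metis mult_div_mod_eq)
    then have eq: "x = int t * (x div int t) + int j" ..
    have "int t * A < int t * (x div int t + 1)" using x assms eq by (simp add: algebra_simps)
    moreover have "x < int t * B" using x by simp
    then have "int t * (x div int t) < int t * B" using eq by linarith
    ultimately show "x div int t \<in> {A..<B}" using assms(1) by simp
    show "g (int t * (x div int t) + int j) = g x" using eq by simp
  next
    fix m assume m: "m \<in> {A..<B}"
    show "(int t * m + int j) div int t = m" using assms by simp
    have "int t * A \<le> int t * m" using m by (intro mult_left_mono) simp_all
    then have "int t * A \<le> int t * m + int j" by linarith
    moreover have "int t * (m + 1) \<le> int t * B" using m by (intro mult_left_mono) simp_all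
    then have "int t * m + int t \<le> int t * B" by (simp only: distrib_left mult_1_right)
    then have "int t * m + int j < int t * B" using assms(2) by linarith
    ultimately show "int t * m + int j \<in> {x\<in>{int t * A..<int t * B}. [x = int j] (mod int t)}"
      using assms by (simp add: cong_def distrib_left)
  qed
  finally show ?thesis .
qed

section \<open>Contents lost with a hook\<close>

lemma sum_cong_window:
  fixes g :: "int \<Rightarrow> int"
  assumes "c \<in> {p<..p + int t}" "[c = s] (mod int t)"
  shows "(\<Sum>x\<in>{p<..p + int t}. if [x = s] (mod int t) then g x else 0) = g c"
proof -
  have "[x = s] (mod int t) \<longleftrightarrow> x = c" if "x \<in> {p<..p + int t}" for x
  proof
    assume "[x = s] (mod int t)"
    then have "[x = c] (mod int t)" using assms(2) cong_sym cong_trans by blast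
    then have "int t dvd x - c" by (simp add: cong_iff_dvd_diff)
    moreover have "\<bar>x - c\<bar> < int t" using that assms(1) by auto
    ultimately have "x - c = 0" using zdvd_not_zless[of "\<bar>x - c\<bar>" "int t"] by auto
    then show "x = c" by simp
  qed (use assms(2) in simp)
  then have "(\<Sum>x\<in>{p<..p + int t}. if [x = s] (mod int t) then g x else 0)
    = (\<Sum>x\<in>{p<..p + int t}. if x = c then g x else 0)" by (intro sum.cong) simp_all
  then show ?thesis using assms(1) by simp
qed

text \<open>Brings an arbitrary function of the content into the difference form of
  \<open>sum_boxes_eq_sum_zero_one\<close>.\<close>

lemma antidifference_exists:
  fixes f :: "int \<Rightarrow> int"
  obtains F where "\<And>c. F c - F (c - 1) = f c"
proof -
  define F where "F m = (if 0 \<le> m then \<Sum>c\<in>{0<..m}. f c else - (\<Sum>c\<in>{m<..0}. f c))" for m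
  have "F c - F (c - 1) = f c" for c
  proof (cases "1 \<le> c")
    case True
    then have "{0<..c} = insert c {0<..c - 1}" by auto
    then show ?thesis using True by (simp add: F_def)
  next
    case False
    then have "{c - 1<..0} = insert c {c<..0}" by auto
    then show ?thesis using False by (auto simp: F_def)
  qed
  then show thesis by (rule that)
qed

lemma sum_antidifference:
  fixes f F :: "int \<Rightarrow> int"
  assumes "\<And>c. F c - F (c - 1) = f c"
  shows "(\<Sum>c\<in>{p<..p + int t}. f c) = F (p + int t) - F p"
proof (induction t)
  case (Suc t)
  have "{p<..p + int (Suc t)} = insert (p + int (Suc t)) {p<..p + int t}" by auto
  then show ?case using Suc assms[of "p + int (Suc t)"] by simp
qed simp

text \<open>Removing a hook of length \<open>t\<close> deletes boxes of \<open>t\<close> consecutive contents.\<close>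

lemma sum_content_remove_hook:
  fixes f :: "int \<Rightarrow> int"
  assumes "young_diagram \<Lambda>" "young_diagram \<Lambda>'" "0 < t"
    and "zero_one \<Lambda> p = 1" "zero_one \<Lambda> (p + int t) = 0"
    and "zero_one \<Lambda>' = (zero_one \<Lambda>)(p := 0, p + int t := 1)"
  shows "(\<Sum>x\<in>\<Lambda>. f (content x)) - (\<Sum>x\<in>\<Lambda>'. f (content x)) = (\<Sum>c\<in>{p<..p + int t}. f c)"
proof -
  obtain F where F: "\<And>c. F c - F (c - 1) = f c" by (rule antidifference_exists[of f]) blast
  obtain K where K: "0 \<le> K" "\<And>m. m < - K \<Longrightarrow> zero_one \<Lambda> m = 0" "\<And>m. K \<le> m \<Longrightarrow> zero_one \<Lambda> m = 1"
    by (rule zero_one_bounds[OF assms(1)]) blast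
  have "\<not> p < - K" using K(2)[of p] assms(4) by auto
  moreover have "\<not> K \<le> p + int t" using K(3)[of "p + int t"] assms(5) by auto
  ultimately have pq: "p \<in> {- K..<K}" "p + int t \<in> {- K..<K}" by auto
  have z': "zero_one \<Lambda>' m = (if m = p + int t then 1 else if m = p then 0 else zero_one \<Lambda> m)" for m
    unfolding assms(6) by simp
  have low: "zero_one \<Lambda>' m = 0" if "m < - K" for m using K(2)[OF that] z'[of m] pq that by simp
  have high: "zero_one \<Lambda>' m = 1" if "K \<le> m" for m using K(3)[OF that] z'[of m] pq that by simp
  have "(\<Sum>x\<in>\<Lambda>. F (content x) - F (content x - 1)) - (\<Sum>x\<in>\<Lambda>'. F (content x) - F (content x - 1))
    = (\<Sum>m\<in>{- K..<K}. ((if m = p + int t then 1 else 0) - (if m = p then 1 else 0)) * F m)"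
    (is "?l - ?l' = _")
  proof -
    have "?l = (\<Sum>m\<in>{- K..<K}. ((if 0 \<le> m then 1 else 0) - int (zero_one \<Lambda> m)) * F m)"
      by (rule sum_boxes_eq_sum_zero_one[OF assms(1) K(2,3)])
    moreover have "?l' = (\<Sum>m\<in>{- K..<K}. ((if 0 \<le> m then 1 else 0) - int (zero_one \<Lambda>' m)) * F m)"
      by (rule sum_boxes_eq_sum_zero_one[OF assms(2) low high])
    moreover have "((if 0 \<le> m then 1 else 0) - int (zero_one \<Lambda> m)) * F m
        - ((if 0 \<le> m then 1 else 0) - int (zero_one \<Lambda>' m)) * F m
      = ((if m = p + int t then 1 else 0) - (if m = p then 1 else 0)) * F m" for m
      using assms(3-5) by (simp add: z')
    ultimately show ?thesis by (simp only: sum_subtractf[symmetric])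
  qed
  also have "\<dots> = F (p + int t) - F p"
    by (rule sum_delta_diff[OF _ pq(2,1)]) simp
  finally show ?thesis using sum_antidifference[of F f p t, OF F] by (simp add: F)
qed

section \<open>Interaction of the moved zero with one other class\<close>

lemma sum_threshold:
  fixes L Q :: "int \<Rightarrow> int"
  assumes "\<And>m. Q (m + 1) - Q m = L m" "A \<le> e" "e \<le> B"
  shows "(\<Sum>m\<in>{A..<B}. if e \<le> m then L m else 0) = Q B - Q e"
proof -
  have "(\<Sum>m\<in>{A..<B}. if e \<le> m then L m else 0) = (\<Sum>m\<in>{e..<B}. L m)"
    using assms(2) by (intro sum.mono_neutral_cong_right) auto
  also have "\<dots> = Q B - Q e"
    using assms(3)
  proof (induction B rule: int_ge_induct)
    case base
    then show ?case by simp
  next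
    case (step B)
    then have "{e..<B + 1} = insert B {e..<B}" by auto
    then show ?case using step assms(1)[of B] by simp
  qed
  finally show ?thesis .
qed

text \<open>A zero moves between positions \<open>p\<close> and \<open>p + t\<close> of residue class \<open>i\<close>; the sum collects its
  interaction with residue class \<open>j\<close>, whose quotient is \<open>\<nu>\<close>.\<close>

lemma sum_interaction:
  fixes t i j :: nat and r d :: int and y :: "int \<Rightarrow> int"
  defines "p \<equiv> int t * r + int i"
  defines "q \<equiv> p + int t"
  assumes "0 < t" "i < t" "j < t" "i \<noteq> j" "young_diagram \<nu>"
    and y: "\<And>m. y (int t * m + int j) = int (zero_one \<nu> (m - d))"
    and low: "\<And>m. m < A \<Longrightarrow> y (int t * m + int j) = 0"
    and high: "\<And>m. B \<le> m \<Longrightarrow> y (int t * m + int j) = 1"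
    and bounds: "A \<le> r" "r + 1 < B" "A \<le> d" "d \<le> B"
  defines "g \<equiv> \<lambda>x. (1 - y x) * ((if p < x then (x - p)\<^sup>2 else 0) - (if q < x then (x - q)\<^sup>2 else 0))
    + y x * ((if x < q then (q - x)\<^sup>2 else 0) - (if x < p then (p - x)\<^sup>2 else 0))"
  shows "(\<Sum>m\<in>{A..<B}. g (int t * m + int j))
    = 2 * int t ^ 2 * int (card \<nu>) + int t ^ 2 * d ^ 2 + 2 * int t * (int j - int i) * d
      - 2 * int t ^ 2 * d * (r + 1) + (q - int j)\<^sup>2"
proof -
  \<comment> \<open>\<open>e\<close> is the one index for which the position in class
    \<open>j\<close> lies strictly between \<open>p\<close> and \<open>q\<close>; it depends on the
    order of \<open>i\<close> and \<open>j\<close>.\<close>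
  define e where "e = (if i < j then r else r + 1)"
  \<comment> \<open>\<open>L m\<close> is the difference of the squared distances of position
    \<open>t * m + j\<close> to \<open>p\<close> and to \<open>q\<close>, and \<open>Q\<close> is an
    antidifference of \<open>L\<close>.\<close>
  define L where "L m = int t * (2 * (int t * m + int j) - 2 * p - int t)" for m
  define Q where "Q m = int t ^ 2 * m * (m - 1) + int t * (2 * int j - 2 * p - int t) * m" for m
  have Q: "Q (m + 1) - Q m = L m" for m
    by (simp add: Q_def L_def power2_eq_square algebra_simps)
  have te: "i < j \<and> int t * e = int t * r \<or> j < i \<and> int t * e = int t * r + int t"
    using assms(6) by (auto simp: e_def distrib_left)
  have x_le: "int t * m + int j < p" if "m < e" for m
  proof -
    have "int t * (m + 1) \<le> int t * e" using that by (intro mult_left_mono) simp_all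
    then have "int t * m + int t \<le> int t * e" by (simp only: distrib_left mult_1_right)
    then show ?thesis unfolding p_def using te assms(4,5) by linarith
  qed
  have x_ge: "q < int t * m + int j" if "e < m" for m
  proof -
    have "int t * (e + 1) \<le> int t * m" using that by (intro mult_left_mono) simp_all
    then have "int t * e + int t \<le> int t * m" by (simp only: distrib_left mult_1_right)
    then show ?thesis unfolding p_def q_def using te assms(4,5) by linarith
  qed
  have x_eq: "p < int t * e + int j" "int t * e + int j < q"
    unfolding p_def q_def using te assms(4,5) by linarith+
  \<comment> \<open>Left of \<open>p\<close> the weight of \<open>L m\<close> is \<open>- y\<close>,
    right of \<open>q\<close> it is \<open>1 - y\<close>; at \<open>m = e\<close> one square comes
    from each side, which equals \<open>(1 - y) * L m\<close> plus an extra square. So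
    \<open>g\<close> is (step at \<open>e\<close> minus \<open>y\<close>) times \<open>L\<close>, up
    to that square. Inserting a step at \<open>d\<close> splits this into a part free of
    \<open>\<nu>\<close> and the deviation of \<open>\<nu>\<close> from the empty diagram.\<close>
  have g: "g (int t * m + int j) = (if m = e then (int t * e + int j - q)\<^sup>2 else 0)
      + ((if e \<le> m then L m else 0) - (if d \<le> m then L m else 0))
      + ((if 0 \<le> m - d then 1 else 0) - int (zero_one \<nu> (m - d))) * L m" for m
  proof -
    have 1: "(x - p)\<^sup>2 - (x - q)\<^sup>2 = int t * (2 * x - 2 * p - int t)" for x
      by (simp add: q_def power2_eq_square algebra_simps)
    have 2: "(q - x)\<^sup>2 - (p - x)\<^sup>2 = - (int t * (2 * x - 2 * p - int t))" for x
      by (simp add: q_def power2_eq_square algebra_simps)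
    have 3: "(x - p)\<^sup>2 = (x - q)\<^sup>2 + int t * (2 * x - 2 * p - int t)" "(q - x)\<^sup>2 = (x - q)\<^sup>2" for x
      by (simp_all add: q_def power2_eq_square algebra_simps)
    have "p < q" using assms(3) by (simp add: q_def)
    define x where "x = int t * m + int j"
    have L: "L m = int t * (2 * x - 2 * p - int t)" by (simp add: L_def x_def)
    have "g x = (if m = e then (int t * e + int j - q)\<^sup>2 else 0) + ((if e \<le> m then 1 else 0) - y x) * L m"
    proof (cases m e rule: linorder_cases)
      case less
      then have "x < p" using x_le by (simp add: x_def)
      then have "g x = y x * ((q - x)\<^sup>2 - (p - x)\<^sup>2)" using \<open>p < q\<close> by (simp add: g_def)
      then show ?thesis using less 2 L by simp
    next
      case equal
      then have "p < x" "x < q" using x_eq by (simp_all add: x_def)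
      then have "g x = (1 - y x) * (x - p)\<^sup>2 + y x * (q - x)\<^sup>2" by (simp add: g_def)
      also have "\<dots> = (x - q)\<^sup>2 + (1 - y x) * L m" unfolding 3[of x] L by (simp add: algebra_simps)
      finally show ?thesis using equal by (simp add: x_def)
    next
      case greater
      then have "q < x" using x_ge by (simp add: x_def)
      then have "g x = (1 - y x) * ((x - p)\<^sup>2 - (x - q)\<^sup>2)" using \<open>p < q\<close> by (simp add: g_def)
      then show ?thesis using greater 1 L by simp
    qed
    then show ?thesis unfolding x_def y by (simp add: algebra_simps)
  qed
  have \<nu>_low: "zero_one \<nu> m = 0" if "m < A - d" for m
    using low[of "m + d"] y[of "m + d"] that by simp
  have \<nu>_high: "zero_one \<nu> m = 1" if "B - d \<le> m" for m
    using high[of "m + d"] y[of "m + d"] that by simp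
  have "(\<Sum>m\<in>{A..<B}. ((if 0 \<le> m - d then 1 else 0) - int (zero_one \<nu> (m - d))) * L m)
    = (\<Sum>m\<in>{A - d..<B - d}. ((if 0 \<le> m then 1 else 0) - int (zero_one \<nu> m)) * L (m + d))"
    by (rule sum.reindex_bij_witness[of _ "\<lambda>m. m + d" "\<lambda>m. m - d"]) auto
  also have "\<dots> = (\<Sum>x\<in>\<nu>. L (content x + d) - L (content x - 1 + d))"
    by (rule sum_boxes_eq_sum_zero_one[OF assms(7) \<nu>_low \<nu>_high, symmetric])
  \<comment> \<open>\<open>L\<close> has slope \<open>2 * t^2\<close>, so all boxes of
    \<open>\<nu>\<close> count alike, whatever their contents.\<close>
  also have "\<dots> = (\<Sum>x\<in>\<nu>. 2 * int t ^ 2)"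
    by (rule sum.cong) (simp_all add: L_def power2_eq_square algebra_simps)
  finally have 1: "(\<Sum>m\<in>{A..<B}. ((if 0 \<le> m - d then 1 else 0) - int (zero_one \<nu> (m - d))) * L m)
    = 2 * int t ^ 2 * int (card \<nu>)" by simp
  have e: "A \<le> e" "e < B" using bounds by (simp_all add: e_def)
  have 2: "(\<Sum>m\<in>{A..<B}. (if e \<le> m then L m else 0) - (if d \<le> m then L m else 0)) = Q d - Q e"
    using sum_threshold[of Q L A e B, OF Q] sum_threshold[of Q L A d B, OF Q] e bounds by (simp add: sum_subtractf)
  have 3: "(\<Sum>m\<in>{A..<B}. if m = e then (int t * e + int j - q)\<^sup>2 else 0) = (int t * e + int j - q)\<^sup>2"
    using e by simp
  have "(\<Sum>m\<in>{A..<B}. g (int t * m + int j))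
    = (int t * e + int j - q)\<^sup>2 + (Q d - Q e) + 2 * int t ^ 2 * int (card \<nu>)"
    unfolding g sum.distrib 1 2 3 ..
  \<comment> \<open>All terms in \<open>e\<close> cancel: the extra square minus \<open>Q e\<close>
    equals the square of \<open>q - j\<close> for every \<open>e\<close>. Thus the order of
    \<open>i\<close> and \<open>j\<close> leaves no trace in the result.\<close>
  also have "\<dots> = 2 * int t ^ 2 * int (card \<nu>) + int t ^ 2 * d ^ 2 + 2 * int t * (int j - int i) * d
      - 2 * int t ^ 2 * d * (r + 1) + (q - int j)\<^sup>2"
    by (simp add: Q_def q_def p_def power2_eq_square algebra_simps)
  finally show ?thesis .
qed

section \<open>Effect of one hook removal\<close>

lemma dvd_iff_of_dvd_diff:
  fixes a b c :: int
  assumes "c dvd a - b"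
  shows "c dvd a \<longleftrightarrow> c dvd b"
  using dvd_add_right_iff[OF assms, of b] by simp

lemma dvd_iff_of_dvd_add:
  fixes a b c :: int
  assumes "c dvd a + b"
  shows "c dvd a \<longleftrightarrow> c dvd b"
  using dvd_iff_of_dvd_diff[of c a "- b"] assms by simp

lemma int_hook_square_sum:
  assumes "young_diagram \<Lambda>"
  shows "int (hook_square_sum t r \<Lambda>)
    = (\<Sum>x\<in>\<Lambda>. if [int (hook \<Lambda> x) = int r] (mod int t) then (int (hook \<Lambda> x))\<^sup>2 else 0)"
  using sum.inter_filter[OF young_diagram_finite[OF assms],
      of "\<lambda>x. (int (hook \<Lambda> x))\<^sup>2" "\<lambda>x. [int (hook \<Lambda> x) = int r] (mod int t)"]
  by (simp add: hook_square_sum_def cong_int_iff)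

lemma content_square_sum_eq:
  assumes "young_diagram \<Lambda>"
  shows "content_square_sum t r \<Lambda>
    = (\<Sum>x\<in>\<Lambda>. if [content x = int r] (mod int t) then (content x)\<^sup>2 else 0)"
  unfolding content_square_sum_def
  by (rule sum.inter_filter[OF young_diagram_finite[OF assms]])

text \<open>The sum in \<open>sum_interaction\<close> without the square that cancels against the contents.\<close>

definition interaction :: "nat \<Rightarrow> int \<Rightarrow> nat \<Rightarrow> nat \<Rightarrow> int \<Rightarrow> int \<Rightarrow> int" where
  "interaction t r i j n d = 2 * int t ^ 2 * n + int t ^ 2 * d ^ 2 + 2 * int t * (int j - int i) * d
    - 2 * int t ^ 2 * d * (r + 1)"

text \<open>Only the classes of p + k and p - k see the moved zero. A position of class
  \<open>j1\<close> is at distance k (mod t) when it lies to the right and at distance t - k when it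
  lies to the left; for \<open>j2\<close> the roles are exchanged. With both residues in
  \<open>w\<close>, each class fits the two-sided form of \<open>sum_interaction\<close>.\<close>

lemma hook_square_sum_remove_hook:
  fixes r :: int and d :: "nat \<Rightarrow> int" and \<nu> :: "nat \<Rightarrow> diagram"
  assumes young: "young_diagram \<Lambda>" "young_diagram \<Lambda>'" and t: "1 \<le> k" "k < t" "i < t"
    and p: "p = int t * r + int i"
    and z: "zero_one \<Lambda> p = 1" "zero_one \<Lambda> (p + int t) = 0"
    and z': "zero_one \<Lambda>' = (zero_one \<Lambda>)(p := 0, p + int t := 1)"
    and \<nu>: "\<And>j. j < t \<Longrightarrow> young_diagram (\<nu> j)"
      "\<And>j m. j < t \<Longrightarrow> zero_one \<Lambda> (int t * m + int j) = zero_one (\<nu> j) (m - d j)"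
    and j1: "j1 < t" "j1 \<noteq> i" "int t dvd p + int k - int j1"
    and j2: "j2 < t" "j2 \<noteq> i" "int t dvd p - int k - int j2"
  shows "(int (hook_square_sum t k \<Lambda>) + int (hook_square_sum t (t - k) \<Lambda>))
      - (int (hook_square_sum t k \<Lambda>') + int (hook_square_sum t (t - k) \<Lambda>'))
    = interaction t r i j1 (int (card (\<nu> j1))) (d j1) + interaction t r i j2 (int (card (\<nu> j2))) (d j2) + (p + int t - int j1)\<^sup>2 + (p + int t - int j2)\<^sup>2"
proof -
  define q where "q = p + int t"
  define w :: "int \<Rightarrow> int" where "w x = (if [x = int k] (mod int t) then x\<^sup>2 else 0)
    + (if [x = int (t - k)] (mod int t) then x\<^sup>2 else 0)" for x
  define W where "W a b = (if a < b then w (b - a) else 0)" for a b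
  define y where "y x = int (zero_one \<Lambda> x)" for x
  define y' where "y' x = int (zero_one \<Lambda>' x)" for x
  have y': "y' = y(p := 0, q := 1)" by (auto simp: y_def y'_def z' q_def)
  have tk: "int (t - k) = int t - int k" using t by simp
  obtain K where K: "0 \<le> K" "\<And>m. m < - K \<Longrightarrow> zero_one \<Lambda> m = 0" "\<And>m. K \<le> m \<Longrightarrow> zero_one \<Lambda> m = 1"
    by (rule zero_one_bounds[OF young(1)]) blast
  \<comment> \<open>The summands beyond \<open>K\<close> place both thresholds \<open>d j1\<close>
    and \<open>d j2\<close> inside the index window, as \<open>sum_interaction\<close>
    requires.\<close>
  define N where "N = K + \<bar>d j1\<bar> + \<bar>d j2\<bar>"
  have N: "0 \<le> N" "K \<le> N" using K(1) by (simp_all add: N_def)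
  have tN: "N \<le> int t * N" using mult_right_mono[of 1 "int t" N] t N by simp
  \<comment> \<open>Bounding \<open>S\<close> by multiples of \<open>t\<close> makes every residue
    class meet it in exactly the indices from \<open>- N\<close> to \<open>N - 1\<close>.\<close>
  define S where "S = {int t * - N..<int t * N}"
  have low: "zero_one \<Lambda> m = 0" if "m < int t * - N" for m using K(2)[of m] that tN N by simp
  have high: "zero_one \<Lambda> m = 1" if "int t * N \<le> m" for m using K(3)[of m] that tN N by simp
  have "int t * - N \<le> p" using low[of p] z(1) by (cases "p < int t * - N") simp_all
  moreover have "q < int t * N" using high[of q] z(2) by (cases "q < int t * N") (simp_all add: q_def)
  moreover have "p < q" using t by (simp add: q_def)
  ultimately have pq: "p \<in> S" "q \<in> S" "p < q" by (simp_all add: S_def)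
  have r: "- N \<le> r" "r + 1 < N"
  proof -
    have "int t * - N \<le> int t * r + int i" using pq(1) by (simp add: S_def p)
    then have "int t * - N < int t * (r + 1)" using t(3) unfolding distrib_left by linarith
    then show "- N \<le> r" using t by (simp only: mult_less_cancel_left_pos)
    have "int t * r + int i + int t < int t * N" using pq(2) by (simp add: S_def q_def p)
    then have "int t * (r + 1) < int t * N" unfolding distrib_left by linarith
    then show "r + 1 < N" using t by (simp only: mult_less_cancel_left_pos)
  qed
  have low': "zero_one \<Lambda>' m = 0" if "m < int t * - N" for m
    using low[OF that] pq that by (simp add: z' S_def q_def)
  have high': "zero_one \<Lambda>' m = 1" if "int t * N \<le> m" for m
    using high[OF that] pq that by (simp add: z' S_def q_def)
  have hooks: "int (hook_square_sum t k \<Lambda>) + int (hook_square_sum t (t - k) \<Lambda>)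
    = (\<Sum>x\<in>\<Lambda>. w (int (hook \<Lambda> x)))" if "young_diagram \<Lambda>" for \<Lambda>
    unfolding int_hook_square_sum[OF that] w_def by (rule sum.distrib[symmetric])
  have "int (hook_square_sum t k \<Lambda>) + int (hook_square_sum t (t - k) \<Lambda>)
    = (\<Sum>a\<in>S. \<Sum>b\<in>S. y a * (1 - y b) * W a b)"
    unfolding hooks[OF young(1)] sum_hook_eq_sum_inversions[OF young(1), where w = w] y_def W_def S_def
    by (rule sum_inversions_eq[OF low high])
  moreover have "int (hook_square_sum t k \<Lambda>') + int (hook_square_sum t (t - k) \<Lambda>')
    = (\<Sum>a\<in>S. \<Sum>b\<in>S. y' a * (1 - y' b) * W a b)"
    unfolding hooks[OF young(2)] sum_hook_eq_sum_inversions[OF young(2), where w = w] y'_def W_def S_def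
    by (rule sum_inversions_eq[OF low' high'])
  moreover have "(\<Sum>a\<in>S. \<Sum>b\<in>S. y a * (1 - y b) * W a b) - (\<Sum>a\<in>S. \<Sum>b\<in>S. y' a * (1 - y' b) * W a b)
    = (\<Sum>x\<in>S. (1 - y x) * (W p x - W q x) + y x * (W x q - W x p))"
  proof (rule sum_move_zero[OF _ pq(1,2) _ _ _ y'])
    \<comment> \<open>The distance \<open>t\<close> of \<open>p\<close> and \<open>q\<close> is
      congruent to neither \<open>k\<close> nor \<open>t - k\<close>; therefore the quadratic part
      of the change vanishes.\<close>
    have "\<not> int t dvd int k" using t zdvd_not_zless[of "int k" "int t"] by simp
    then have "\<not> [int t = int k] (mod int t)" "\<not> [int t = int (t - k)] (mod int t)"
      using dvd_iff_of_dvd_add[of "int t" "int t - int k" "int k"] by (simp_all add: cong_iff_dvd_diff tk)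
    then have "w (int t) = 0" by (simp add: w_def)
    then show "W p q = 0" by (simp add: W_def q_def)
    show "W q p = 0" "W p p = 0" "W q q = 0" using pq by (simp_all add: W_def)
  qed (use pq(3) z in \<open>simp_all add: S_def y_def q_def\<close>)
  moreover have "(\<Sum>x\<in>S. (1 - y x) * (W p x - W q x) + y x * (W x q - W x p)) =
    (\<Sum>x\<in>S. (if [x = int j1] (mod int t) then
        (1 - y x) * ((if p < x then (x - p)\<^sup>2 else 0) - (if q < x then (x - q)\<^sup>2 else 0))
        + y x * ((if x < q then (q - x)\<^sup>2 else 0) - (if x < p then (p - x)\<^sup>2 else 0)) else 0))
    + (\<Sum>x\<in>S. (if [x = int j2] (mod int t) then
        (1 - y x) * ((if p < x then (x - p)\<^sup>2 else 0) - (if q < x then (x - q)\<^sup>2 else 0))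
        + y x * ((if x < q then (q - x)\<^sup>2 else 0) - (if x < p then (p - x)\<^sup>2 else 0)) else 0))"
    unfolding sum.distrib[symmetric]
  proof (rule sum.cong[OF refl])
    fix x
    \<comment> \<open>If \<open>t = 2 * k\<close>, then \<open>j1 = j2\<close>, and both
      \<open>w\<close> and the sum \<open>I j1 + I j2\<close> count this class twice.\<close>
    define I where "I j = (if [x = int j] (mod int t) then 1 else 0 :: int)" for j
    have right: "w (x - u) = (I j1 + I j2) * (x - u)\<^sup>2" if "int t dvd u - p" for u
    proof -
      have "int t dvd (x - u - int k) - (x - int j1)"
        using dvd_add[OF that j1(3)] dvd_minus_iff[of "int t" "(x - u - int k) - (x - int j1)"]
        by (simp add: algebra_simps)
      then have "[x - u = int k] (mod int t) \<longleftrightarrow> [x = int j1] (mod int t)"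
        using dvd_iff_of_dvd_diff unfolding cong_iff_dvd_diff by blast
      moreover have "int t dvd (x - u - int (t - k)) - (x - int j2)"
        using dvd_add[OF dvd_add[OF that j2(3)] dvd_refl]
          dvd_minus_iff[of "int t" "(x - u - int (t - k)) - (x - int j2)"]
        by (simp add: algebra_simps tk)
      then have "[x - u = int (t - k)] (mod int t) \<longleftrightarrow> [x = int j2] (mod int t)"
        using dvd_iff_of_dvd_diff unfolding cong_iff_dvd_diff by blast
      ultimately show ?thesis by (simp add: w_def I_def)
    qed
    have left: "w (u - x) = (I j1 + I j2) * (u - x)\<^sup>2" if "int t dvd u - p" for u
    proof -
      have "int t dvd (u - x - int k) + (x - int j2)"
        using dvd_add[OF that j2(3)] by (simp add: algebra_simps)
      then have "[u - x = int k] (mod int t) \<longleftrightarrow> [x = int j2] (mod int t)"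
        using dvd_iff_of_dvd_add unfolding cong_iff_dvd_diff by blast
      moreover have "int t dvd (u - x - int (t - k)) + (x - int j1)"
        using dvd_diff[OF dvd_add[OF that j1(3)] dvd_refl] by (simp add: algebra_simps tk)
      then have "[u - x = int (t - k)] (mod int t) \<longleftrightarrow> [x = int j1] (mod int t)"
        using dvd_iff_of_dvd_add unfolding cong_iff_dvd_diff by blast
      ultimately show ?thesis by (simp add: w_def I_def)
    qed
    have "int t dvd p - p" "int t dvd q - p" by (simp_all add: q_def)
    note right = right[OF this(1)] right[OF this(2)] and left = left[OF this(1)] left[OF this(2)]
    have W: "W p x = (I j1 + I j2) * (if p < x then (x - p)\<^sup>2 else 0)"
      "W q x = (I j1 + I j2) * (if q < x then (x - q)\<^sup>2 else 0)"
      "W x q = (I j1 + I j2) * (if x < q then (q - x)\<^sup>2 else 0)"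
      "W x p = (I j1 + I j2) * (if x < p then (p - x)\<^sup>2 else 0)"
      by (simp_all add: W_def right left)
    define g where "g = (1 - y x) * ((if p < x then (x - p)\<^sup>2 else 0) - (if q < x then (x - q)\<^sup>2 else 0))
        + y x * ((if x < q then (q - x)\<^sup>2 else 0) - (if x < p then (p - x)\<^sup>2 else 0))"
    have "(1 - y x) * (W p x - W q x) + y x * (W x q - W x p) = I j1 * g + I j2 * g"
      unfolding W g_def by (simp only: distrib_left distrib_right left_diff_distrib right_diff_distrib ac_simps)
    then show "(1 - y x) * (W p x - W q x) + y x * (W x q - W x p) =
      (if [x = int j1] (mod int t) then
        (1 - y x) * ((if p < x then (x - p)\<^sup>2 else 0) - (if q < x then (x - q)\<^sup>2 else 0))
        + y x * ((if x < q then (q - x)\<^sup>2 else 0) - (if x < p then (p - x)\<^sup>2 else 0)) else 0)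
      + (if [x = int j2] (mod int t) then
        (1 - y x) * ((if p < x then (x - p)\<^sup>2 else 0) - (if q < x then (x - q)\<^sup>2 else 0))
        + y x * ((if x < q then (q - x)\<^sup>2 else 0) - (if x < p then (p - x)\<^sup>2 else 0)) else 0)"
      unfolding g_def[symmetric] by (simp add: I_def)
  qed
  moreover have "(\<Sum>x\<in>S. (if [x = int j] (mod int t) then
        (1 - y x) * ((if p < x then (x - p)\<^sup>2 else 0) - (if q < x then (x - q)\<^sup>2 else 0))
        + y x * ((if x < q then (q - x)\<^sup>2 else 0) - (if x < p then (p - x)\<^sup>2 else 0)) else 0))
    = interaction t r i j (int (card (\<nu> j))) (d j) + (p + int t - int j)\<^sup>2" if j: "j < t" "j \<noteq> i" and dj: "\<bar>d j\<bar> \<le> N" for j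
  proof -
    have "y (int t * m + int j) = int (zero_one (\<nu> j) (m - d j))" for m
      using \<nu>(2)[OF j(1)] by (simp add: y_def)
    moreover have "y (int t * m + int j) = 0" if "m < - N" for m
    proof -
      have "int t * (m + 1) \<le> int t * - N" using that by (intro mult_left_mono) simp_all
      then have "int t * m + int j < int t * - N" using j(1) unfolding distrib_left by linarith
      then show ?thesis using low by (simp add: y_def)
    qed
    moreover have "y (int t * m + int j) = 1" if "N \<le> m" for m
    proof -
      have "int t * N \<le> int t * m" using that by (intro mult_left_mono) simp_all
      then have "int t * N \<le> int t * m + int j" by linarith
      then show ?thesis using high by (simp add: y_def)
    qed
    moreover have "- N \<le> d j" "d j \<le> N" using dj by simp_all
    moreover have "0 < t" using t by simp
    ultimately show ?thesis
      unfolding S_def sum_residue_class[OF \<open>0 < t\<close> j(1)] interaction_def q_def p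
      using sum_interaction[OF _ t(3) j(1) j(2)[symmetric] \<nu>(1)[OF j(1)], of y "d j" "- N" N r] r
      by simp
  qed
  then have "(\<Sum>x\<in>S. (if [x = int j1] (mod int t) then
        (1 - y x) * ((if p < x then (x - p)\<^sup>2 else 0) - (if q < x then (x - q)\<^sup>2 else 0))
        + y x * ((if x < q then (q - x)\<^sup>2 else 0) - (if x < p then (p - x)\<^sup>2 else 0)) else 0))
    = interaction t r i j1 (int (card (\<nu> j1))) (d j1) + (p + int t - int j1)\<^sup>2"
    "(\<Sum>x\<in>S. (if [x = int j2] (mod int t) then
        (1 - y x) * ((if p < x then (x - p)\<^sup>2 else 0) - (if q < x then (x - q)\<^sup>2 else 0))
        + y x * ((if x < q then (q - x)\<^sup>2 else 0) - (if x < p then (p - x)\<^sup>2 else 0)) else 0))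
    = interaction t r i j2 (int (card (\<nu> j2))) (d j2) + (p + int t - int j2)\<^sup>2"
    using j1 j2 K(1) by (simp_all add: N_def)
  ultimately show ?thesis by simp
qed

text \<open>Since \<open>0 \<le> j < t\<close>, the number \<open>p + t - j\<close> is one of the
  \<open>t\<close> lost contents, and the only one in its residue class. For \<open>j2\<close> this
  is the class of \<open>k\<close>, for \<open>j1\<close> the class of \<open>t - k\<close>.\<close>

lemma content_square_sum_remove_hook:
  assumes "young_diagram \<Lambda>" "young_diagram \<Lambda>'" and t: "k < t"
    and "zero_one \<Lambda> p = 1" "zero_one \<Lambda> (p + int t) = 0"
    and "zero_one \<Lambda>' = (zero_one \<Lambda>)(p := 0, p + int t := 1)"
    and j1: "j1 < t" "int t dvd p + int k - int j1"
    and j2: "j2 < t" "int t dvd p - int k - int j2"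
  shows "(content_square_sum t k \<Lambda> + content_square_sum t (t - k) \<Lambda>)
      - (content_square_sum t k \<Lambda>' + content_square_sum t (t - k) \<Lambda>')
    = (p + int t - int j1)\<^sup>2 + (p + int t - int j2)\<^sup>2"
proof -
  have *: "content_square_sum t s \<Lambda> - content_square_sum t s \<Lambda>' = (p + int t - int j)\<^sup>2"
    if "j < t" "[p + int t - int j = int s] (mod int t)" for s j
  proof -
    have "content_square_sum t s \<Lambda> - content_square_sum t s \<Lambda>'
      = (\<Sum>c\<in>{p<..p + int t}. if [c = int s] (mod int t) then c\<^sup>2 else 0)"
      unfolding content_square_sum_eq[OF assms(1)] content_square_sum_eq[OF assms(2)]
      using t by (intro sum_content_remove_hook[OF assms(1,2) _ assms(4-6)]) simp
    also have "\<dots> = (p + int t - int j)\<^sup>2"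
      using that by (intro sum_cong_window) simp_all
    finally show ?thesis .
  qed
  have "int t dvd (p + int t - int j2) - int k" using dvd_add[OF j2(2) dvd_refl] by (simp add: algebra_simps)
  moreover have "int t dvd (p + int t - int j1) - int (t - k)"
    using j1(2) t by (simp add: algebra_simps)
  ultimately show ?thesis
    using *[OF j2(1), of k] *[OF j1(1), of "t - k"] by (simp add: cong_iff_dvd_diff)
qed

subsection \<open>Induction along hook removals\<close>

definition hook_content_diff :: "nat \<Rightarrow> nat \<Rightarrow> diagram \<Rightarrow> int" where
  "hook_content_diff t k \<Lambda> = int (hook_square_sum t k \<Lambda>) + int (hook_square_sum t (t - k) \<Lambda>)
    - (content_square_sum t k \<Lambda> + content_square_sum t (t - k) \<Lambda>)"

lemma hook_content_diff_remove_hook: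
  fixes r :: int and d :: "nat \<Rightarrow> int" and \<nu> :: "nat \<Rightarrow> diagram"
  assumes "young_diagram \<Lambda>" "young_diagram \<Lambda>'" "1 \<le> k" "k < t" "i < t"
    and "p = int t * r + int i"
    and "zero_one \<Lambda> p = 1" "zero_one \<Lambda> (p + int t) = 0"
    and "zero_one \<Lambda>' = (zero_one \<Lambda>)(p := 0, p + int t := 1)"
    and "\<And>j. j < t \<Longrightarrow> young_diagram (\<nu> j)"
      "\<And>j m. j < t \<Longrightarrow> zero_one \<Lambda> (int t * m + int j) = zero_one (\<nu> j) (m - d j)"
    and "j1 < t" "j1 \<noteq> i" "int t dvd p + int k - int j1"
    and "j2 < t" "j2 \<noteq> i" "int t dvd p - int k - int j2"
  shows "hook_content_diff t k \<Lambda> - hook_content_diff t k \<Lambda>'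
    = interaction t r i j1 (int (card (\<nu> j1))) (d j1) + interaction t r i j2 (int (card (\<nu> j2))) (d j2)"
  using hook_square_sum_remove_hook[OF assms(1-9), of \<nu> d j1 j2] assms(10-17)
    content_square_sum_remove_hook[OF assms(1,2,4,7-9,12,14,15,17)]
  by (simp add: hook_content_diff_def)

text \<open>The summand for $(i, j)$ with $b_i = t d_i + i$ and $q_3(\lambda^i) = 6 c_i$ substituted.\<close>

definition pair_term :: "nat \<Rightarrow> (nat \<Rightarrow> int) \<Rightarrow> (nat \<Rightarrow> int) \<Rightarrow> (nat \<Rightarrow> int) \<Rightarrow> nat \<Rightarrow> nat \<Rightarrow> int" where
  "pair_term t d n c i j = 2 * int t ^ 2 * n i * n j
    + int t * (int t * d j + 2 * int j - 2 * (int t * d i + int i)) * d j * n i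
    + int t * (int t * d i + 2 * int i - 2 * (int t * d j + int j)) * d i * n j
    - 2 * int t ^ 2 * (d j * c i + d i * c j)"

lemma pair_term_commute: "pair_term t d n c i j = pair_term t d n c j i"
  by (simp add: pair_term_def algebra_simps)

text \<open>\<open>r + 1 - d i\<close> is the content of the box added to quotient \<open>i\<close>.
  Its part \<open>- d i\<close> cancels the product of \<open>d i\<close> and \<open>d j\<close>
  that comes from \<open>b_i\<close>, so the change no longer involves \<open>d i\<close>.\<close>

lemma pair_term_update:
  assumes "i \<noteq> j"
  shows "pair_term t d (n(i := n i + 1)) (c(i := c i + (r + 1 - d i))) i j - pair_term t d n c i j
    = interaction t r i j (n j) (d j)"
  using assms by (simp add: pair_term_def interaction_def power2_eq_square algebra_simps)

text \<open>In the cyclic sum the index \<open>i\<close> occurs in two summands: first with partner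
  \<open>j1\<close>, and second with partner \<open>j2\<close>. They stay distinct summands even if
  \<open>j1 = j2\<close>.\<close>

lemma sum_pair_term_update:
  fixes n c d :: "nat \<Rightarrow> int" and i k t :: nat and r :: int
  assumes "1 \<le> k" "k < t" "i < t"
  defines "n' \<equiv> n(i := n i + 1)" and "c' \<equiv> c(i := c i + (r + 1 - d i))"
    and "j1 \<equiv> (i + k) mod t" and "j2 \<equiv> (i + (t - k)) mod t"
  shows "(\<Sum>s<t. pair_term t d n' c' s ((s + k) mod t)) - (\<Sum>s<t. pair_term t d n c s ((s + k) mod t))
    = interaction t r i j1 (n j1) (d j1) + interaction t r i j2 (n j2) (d j2)"
proof -
  have mod_eq: "(a + b) mod t = (if a + b < t then a + b else a + b - t)" if "a < t" "b < t" for a b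
    using that by (simp add: mod_if)
  have j1: "j1 < t" "j1 \<noteq> i" using assms(1-3) by (auto simp: j1_def mod_eq)
  have j2_eq: "j2 = (if i < k then i + t - k else i - k)"
    using mod_eq[OF assms(3), of "t - k"] assms(1-3) unfolding j2_def by (cases "i < k") auto
  have j2_iff: "(s + k) mod t = i \<longleftrightarrow> s = j2" if "s < t" for s
    unfolding mod_eq[OF that assms(2)] j2_eq using assms(1-3) that by auto
  have j2: "j2 < t" "j2 \<noteq> i" using assms(1-3) by (auto simp: j2_eq)
  then have j2k: "(j2 + k) mod t = i" using j2_iff by blast
  have "pair_term t d n' c' s ((s + k) mod t) - pair_term t d n c s ((s + k) mod t)
    = (if s = i then interaction t r i j1 (n j1) (d j1) else 0)
      + (if s = j2 then interaction t r i j2 (n j2) (d j2) else 0)" if "s < t" for s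
  proof -
    consider "s = i" | "s = j2" | "s \<noteq> i" "s \<noteq> j2" by blast
    then show ?thesis
    proof cases
      case 1
      then show ?thesis
        using pair_term_update[OF j1(2)[symmetric]] j2(2) by (simp add: j1_def n'_def c'_def)
    next
      case 2
      then show ?thesis
        using pair_term_update[OF j2(2)[symmetric]] j2 j2k
        by (simp add: pair_term_commute[of _ _ _ _ j2] n'_def c'_def)
    next
      case 3
      moreover have "(s + k) mod t \<noteq> i" using j2_iff[OF that] 3 by simp
      ultimately show ?thesis by (simp add: pair_term_def n'_def c'_def)
    qed
  qed
  then have "(\<Sum>s<t. pair_term t d n' c' s ((s + k) mod t)) - (\<Sum>s<t. pair_term t d n c s ((s + k) mod t))
    = (\<Sum>s<t. (if s = i then interaction t r i j1 (n j1) (d j1) else 0)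
      + (if s = j2 then interaction t r i j2 (n j2) (d j2) else 0))"
    unfolding sum_subtractf[symmetric] by (intro sum.cong) simp_all
  then show ?thesis using assms(3) j2(1) by (simp add: sum.distrib)
qed

text \<open>Removing a \<open>t\<close>-hook removes a box from a single quotient, so the quotients can be built up
  along the chain of hook removals.\<close>

lemma hook_content_diff_expansion:
  assumes "is_core t M" "1 \<le> k" "k < t" "(removes_hook t)\<^sup>*\<^sup>* \<Lambda> M"
  shows "\<exists>\<nu>. (\<forall>j<t. young_diagram (\<nu> j)
      \<and> (\<forall>m. zero_one \<Lambda> (int t * m + int j) = zero_one (\<nu> j) (m - core_d t M j)))
    \<and> hook_content_diff t k \<Lambda> = hook_content_diff t k M
      + (\<Sum>s<t. pair_term t (core_d t M) (\<lambda>j. int (card (\<nu> j))) (\<lambda>j. \<Sum>x\<in>\<nu> j. content x) s ((s + k) mod t))"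
  using assms(4)
proof (induction rule: converse_rtranclp_induct)
  case base
  have "0 < t" using assms by simp
  \<comment> \<open>Each class of the core is the sequence of the empty diagram shifted by
    \<open>core_d t M j\<close>. The same shift is kept along the whole chain, so no re-balancing
    occurs in the induction.\<close>
  from core_zero_one(1)[OF assms(1) this]
  have "zero_one M (int t * m + int j) = zero_one {} (m - core_d t M j)" if "j < t" for j m
    using that by (simp add: zero_one_empty)
  then show ?case by (intro exI[of _ "\<lambda>_. {}"]) (simp add: pair_term_def)
next
  case (step \<Lambda> \<Lambda>')
  define d where "d = core_d t M"
  have t: "0 < t" using assms by simp
  obtain \<nu>' where \<nu>': "\<And>j. j < t \<Longrightarrow> young_diagram (\<nu>' j)"
      "\<And>j m. j < t \<Longrightarrow> zero_one \<Lambda>' (int t * m + int j) = zero_one (\<nu>' j) (m - d j)"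
    and IH: "hook_content_diff t k \<Lambda>' = hook_content_diff t k M
      + (\<Sum>s<t. pair_term t d (\<lambda>j. int (card (\<nu>' j))) (\<lambda>j. \<Sum>x\<in>\<nu>' j. content x) s ((s + k) mod t))"
    using step.IH unfolding d_def by blast
  obtain p where young: "young_diagram \<Lambda>" "young_diagram \<Lambda>'"
    and p: "zero_one \<Lambda> p = 1" "zero_one \<Lambda> (p + int t) = 0"
      "zero_one \<Lambda>' = (zero_one \<Lambda>)(p := 0, p + int t := 1)"
    using step.hyps(1) unfolding removes_hook_def by blast
  define i where "i = nat (p mod int t)"
  define r where "r = p div int t"
  have i: "i < t" "int i = p mod int t" using t by (simp_all add: i_def nat_less_iff)
  have p_eq: "p = int t * r + int i" using i(2) by (simp add: r_def)
  have pt_eq: "p + int t = int t * (r + 1) + int i" by (simp add: p_eq distrib_left)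
  have "zero_one \<Lambda>' p = 0" "zero_one \<Lambda>' (p + int t) = 1" using t by (simp_all add: p(3))
  \<comment> \<open>In class \<open>i\<close> the positions \<open>p\<close> and
    \<open>p + t\<close> are neighbours. The zero followed by a one that the removal leaves there is
    a place where a box can be put back.\<close>
  from this(1)[unfolded p_eq \<nu>'(2)[OF i(1)]] this(2)[unfolded pt_eq \<nu>'(2)[OF i(1)]]
  have "zero_one (\<nu>' i) (r + 1 - d i - 1) = 0" "zero_one (\<nu>' i) (r + 1 - d i) = 1" by simp_all
  then obtain x where x: "x \<notin> \<nu>' i" "young_diagram (insert x (\<nu>' i))" "content x = r + 1 - d i"
    "zero_one (insert x (\<nu>' i)) = (zero_one (\<nu>' i))(r + 1 - d i - 1 := 1, r + 1 - d i := 0)"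
    by (rule add_box[OF \<nu>'(1)[OF i(1)]])
  define \<nu> where "\<nu> = \<nu>'(i := insert x (\<nu>' i))"
  have \<nu>_young: "young_diagram (\<nu> j)" if "j < t" for j
    using \<nu>'(1)[OF that] x(2) by (simp add: \<nu>_def)
  have pos_eq_iff: "int t * m + int j = int t * m' + int i \<longleftrightarrow> j = i \<and> m = m'" if "j < t" for j m m'
  proof
    assume *: "int t * m + int j = int t * m' + int i"
    have "(int t * m + int j) mod int t = int j" "(int t * m' + int i) mod int t = int i"
      using that i(1) by simp_all
    then have "j = i" using * by simp
    then show "j = i \<and> m = m'" using * t by simp
  qed simp
  have \<nu>_zero_one: "zero_one \<Lambda> (int t * m + int j) = zero_one (\<nu> j) (m - d j)" if "j < t" for j m
  proof -
    let ?u = "int t * m + int j"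
    have "zero_one \<Lambda> ?u = (if ?u = p then 1 else if ?u = p + int t then 0 else zero_one \<Lambda>' ?u)"
      using p by simp
    moreover have "?u = p \<longleftrightarrow> j = i \<and> m = r" using pos_eq_iff[OF that] p_eq by simp
    moreover have "?u = p + int t \<longleftrightarrow> j = i \<and> m = r + 1"
      using pos_eq_iff[OF that, of m "r + 1"] unfolding pt_eq by simp
    ultimately show ?thesis using \<nu>'(2)[OF that, of m] x(4) by (simp add: \<nu>_def)
  qed
  define j1 where "j1 = (i + k) mod t"
  define j2 where "j2 = (i + (t - k)) mod t"
  have j: "j1 < t" "j1 \<noteq> i" "j2 < t" "j2 \<noteq> i"
    using assms(2,3) i(1) by (auto simp: j1_def j2_def mod_if)
  have "int t dvd int (i + k) - int j1" "int t dvd int (i + (t - k)) - int j2"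
    unfolding j1_def j2_def zmod_int by (simp_all only: dvd_minus_mod)
  \<comment> \<open>\<open>i + (t - k)\<close> exceeds \<open>i - k\<close> by \<open>t\<close>,
    hence \<open>r - 1\<close> instead of \<open>r\<close> for \<open>j2\<close>.\<close>
  then have "int t dvd (int (i + k) - int j1) + int t * r"
    "int t dvd (int (i + (t - k)) - int j2) + int t * (r - 1)" by (simp_all only: dvd_add dvd_triv_left)
  then have dvd: "int t dvd p + int k - int j1" "int t dvd p - int k - int j2"
    using assms(3) by (simp_all add: p_eq algebra_simps)
  have "hook_content_diff t k \<Lambda> - hook_content_diff t k \<Lambda>'
    = interaction t r i j1 (int (card (\<nu> j1))) (d j1) + interaction t r i j2 (int (card (\<nu> j2))) (d j2)"
    by (rule hook_content_diff_remove_hook[OF young assms(2,3) i(1) p_eq p \<nu>_young \<nu>_zero_one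
          j(1,2) dvd(1) j(3,4) dvd(2)])
  \<comment> \<open>The hook moves a zero inside class \<open>i\<close> only, so the quotients at
    \<open>j1\<close> and \<open>j2\<close> are the same before and after.\<close>
  also have "\<dots> = interaction t r i j1 (int (card (\<nu>' j1))) (d j1) + interaction t r i j2 (int (card (\<nu>' j2))) (d j2)"
    using j by (simp add: \<nu>_def)
  also have "\<dots> = (\<Sum>s<t. pair_term t d (\<lambda>j. int (card (\<nu> j))) (\<lambda>j. \<Sum>x\<in>\<nu> j. content x) s ((s + k) mod t))
    - (\<Sum>s<t. pair_term t d (\<lambda>j. int (card (\<nu>' j))) (\<lambda>j. \<Sum>x\<in>\<nu>' j. content x) s ((s + k) mod t))"
  proof -
    have fin: "finite (\<nu>' i)" by (rule young_diagram_finite[OF \<nu>'(1)[OF i(1)]])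
    have "(\<lambda>j. int (card (\<nu> j))) = (\<lambda>j. int (card (\<nu>' j)))(i := int (card (\<nu>' i)) + 1)"
      using x(1) fin by (auto simp: \<nu>_def)
    moreover have "(\<lambda>j. \<Sum>x\<in>\<nu> j. content x)
      = (\<lambda>j. \<Sum>x\<in>\<nu>' j. content x)(i := (\<Sum>x\<in>\<nu>' i. content x) + (r + 1 - d i))"
      using x(1,3) fin by (auto simp: \<nu>_def)
    ultimately show ?thesis
      using sum_pair_term_update[OF assms(2,3) i(1), of d "\<lambda>j. int (card (\<nu>' j))"
          "\<lambda>j. \<Sum>x\<in>\<nu>' j. content x" r]
      by (simp only: j1_def j2_def)
  qed
  finally have "hook_content_diff t k \<Lambda> = hook_content_diff t k M
      + (\<Sum>s<t. pair_term t d (\<lambda>j. int (card (\<nu> j))) (\<lambda>j. \<Sum>x\<in>\<nu> j. content x) s ((s + k) mod t))"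
    using IH by simp
  then show ?case using \<nu>_young \<nu>_zero_one unfolding d_def by (intro exI[of _ \<nu>]) simp
qed

text \<open>\<open>B_pairs\<close> lists the steps from s to s + k on the cycle of residues. Its
  second half contains the steps that wrap around, written backwards, so symmetry of
  \<open>E\<close> is what turns them round. For \<open>t = 2 * k\<close> each pair occurs twice on
  both sides.\<close>

lemma sum_B_pairs:
  fixes E :: "nat \<Rightarrow> nat \<Rightarrow> real"
  assumes "1 \<le> k" "k < t" "\<And>i j. E i j = E j i"
  shows "(\<Sum>(i, j)\<in>#B_pairs t k. E i j) = (\<Sum>s<t. E s ((s + k) mod t))"
proof -
  have "(\<Sum>(i, j)\<in>#B_pairs t k. E i j)
    = (\<Sum>i\<in>{0..t - 1 - k}. E i (i + k)) + (\<Sum>i\<in>{0..k - 1}. E i (i + t - k))"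
    by (simp add: B_pairs_def sum_unfold_sum_mset image_mset.compositionality comp_def)
  also have "(\<Sum>i\<in>{0..t - 1 - k}. E i (i + k)) = (\<Sum>s\<in>{0..<t - k}. E s ((s + k) mod t))"
    using assms by (intro sum.cong) auto
  also have "(\<Sum>i\<in>{0..k - 1}. E i (i + t - k)) = (\<Sum>s\<in>{t - k..<t}. E s ((s + k) mod t))"
  proof (rule sum.reindex_bij_witness[of _ "\<lambda>s. s + k - t" "\<lambda>i. i + t - k"])
    fix i assume "i \<in> {0..k - 1}"
    then show "E (i + t - k) ((i + t - k + k) mod t) = E i (i + t - k)"
      using assms by (subst assms(3)) simp
  qed (use assms in auto)
  also have "(\<Sum>s\<in>{0..<t - k}. E s ((s + k) mod t)) + (\<Sum>s\<in>{t - k..<t}. E s ((s + k) mod t))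
    = (\<Sum>s\<in>{0..<t}. E s ((s + k) mod t))"
    by (rule sum.atLeastLessThan_concat) simp_all
  finally show ?thesis by (simp add: atLeast0LessThan)
qed

theorem theorem6p1:
  fixes t k :: nat and M \<Lambda> :: diagram
    and n :: "nat \<Rightarrow> nat" and b d q :: "nat \<Rightarrow> int"
  assumes "0 < t" and "is_core t M" and "1 \<le> k" and "k \<le> t - 1"
    and "young_diagram \<Lambda>" and "has_core t \<Lambda> M"
  defines "n \<equiv> \<lambda>i. card (t_quotient t \<Lambda> i)"
    and "b \<equiv> core_b t M"
    and "d \<equiv> core_d t M"
    and "q \<equiv> \<lambda>i. q3 (t_quotient t \<Lambda> i)"
  shows
    "real (hook_square_sum t k \<Lambda>) + real (hook_square_sum t (t - k) \<Lambda>)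
       - (real_of_int (content_square_sum t k \<Lambda>) + real_of_int (content_square_sum t (t - k) \<Lambda>))
     = real (hook_square_sum t k M) + real (hook_square_sum t (t - k) M)
       - (real_of_int (content_square_sum t k M) + real_of_int (content_square_sum t (t - k) M))
       + (\<Sum>(i, j)\<in>#B_pairs t k.
            2 * (real t)\<^sup>2 * real (n i) * real (n j)
            + real t * (real_of_int (b j) + real j - 2 * real_of_int (b i)) * real_of_int (d j) * real (n i)
            + real t * (real_of_int (b i) + real i - 2 * real_of_int (b j)) * real_of_int (d i) * real (n j)
            - 1 / 3 * (real t)\<^sup>2 * (real_of_int (d j) * real_of_int (q i) + real_of_int (d i) * real_of_int (q j)))"
    (is "_ = _ + (\<Sum>(i, j)\<in>#B_pairs t k. ?E i j)")
proof -
  have k: "k < t" using assms(1,3,4) by simp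
  obtain \<nu> where \<nu>: "\<And>j. j < t \<Longrightarrow> young_diagram (\<nu> j)"
      "\<And>j m. j < t \<Longrightarrow> zero_one \<Lambda> (int t * m + int j) = zero_one (\<nu> j) (m - d j)"
    and expansion: "hook_content_diff t k \<Lambda> = hook_content_diff t k M
      + (\<Sum>s<t. pair_term t d (\<lambda>j. int (card (\<nu> j))) (\<lambda>j. \<Sum>x\<in>\<nu> j. content x) s ((s + k) mod t))"
    using hook_content_diff_expansion[OF assms(2,3) k] assms(6) unfolding has_core_def d_def by blast
  have "t_quotient t \<Lambda> j = \<nu> j" if "j < t" for j
    using \<nu>[OF that] by (intro t_quotient_eqI[where s = "- d j"]) simp_all
  then have nq: "n j = card (\<nu> j)" "q j = 6 * (\<Sum>x\<in>\<nu> j. content x)" if "j < t" for j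
    using that q3_eq_sum_content[OF \<nu>(1)[OF that]] by (simp_all add: n_def q_def)
  have bd: "b j = int t * d j + int j" if "j < t" for j
    unfolding b_def d_def by (rule core_zero_one(2)[OF assms(2,1) that])
  \<comment> \<open>Here \<open>b j + j\<close> becomes \<open>t * d j + 2 * j\<close>, and a third
    of \<open>q j = 6 * c j\<close> gives the coefficient 2 in \<open>pair_term\<close>, which is
    why the latter can be integral.\<close>
  have E: "?E i j = real_of_int (pair_term t d (\<lambda>j. int (card (\<nu> j))) (\<lambda>j. \<Sum>x\<in>\<nu> j. content x) i j)"
    if "i < t" "j < t" for i j
    unfolding nq[OF that(1)] nq[OF that(2)] bd[OF that(1)] bd[OF that(2)]
    by (simp add: pair_term_def algebra_simps)
  have "(\<Sum>(i, j)\<in>#B_pairs t k. ?E i j) = (\<Sum>s<t. ?E s ((s + k) mod t))"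
    by (rule sum_B_pairs[OF assms(3) k]) (simp add: algebra_simps)
  also have "\<dots> = real_of_int (\<Sum>s<t. pair_term t d (\<lambda>j. int (card (\<nu> j))) (\<lambda>j. \<Sum>x\<in>\<nu> j. content x) s ((s + k) mod t))"
    unfolding of_int_sum using k by (intro sum.cong refl E) simp_all
  also have "\<dots> = real_of_int (hook_content_diff t k \<Lambda> - hook_content_diff t k M)"
    using expansion by simp
  finally show ?thesis by (simp add: hook_content_diff_def)
qed

end
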